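(* Assume the standing assumptions below hold and let $g\in H^1(0,T)$ with $g(0)=0$. Let $u=u(x,t;g)$ be the weak solution of the forward problem (P). Then \[ \|u_{xx}\|^2_{L^\infty(0,T;L^2(0,\ell))}\le C_1^2\,\|g'\|^2_{L^2(0,T)},\qquad \|u_{xx}\|^2_{L^2(0,T;L^2(0,\ell))}\le C_2^2\,\|g'\|^2_{L^2(0,T)}, \] \[ \|u_{t}\|^2_{L^2(0,T;L^2(0,\ell))}\le \frac{r_0}{2\rho_0}\,C_2^2\,\|g'\|^2_{L^2(0,T)},\qquad \|u_{xxt}\|^2_{L^2(0,T;L^2(0,\ell))}\le \frac{r_0}{4\kappa_0}\,C_2^2\,\|g'\|^2_{L^2(0,T)}, \] where \[ C_0^2=\frac{4\hat\ell(1+T)}{r_0^2},\quad \hat\ell=\ell+\frac{\ell^3}{3},\quad C_\theta^2=\Big(\frac{2h\cos\theta}{\pi}\Big)^2,\quad C_e^2=e^{T}, \] \[ C_1^2=C_0^2(1+C_\theta^2)C_e^2,\qquad C_2^2=C_0^2(1+C_\theta^2)(1+C_e^2). \]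
   Context: Standing assumptions: $\ell>0$, $T>0$, $\Omega_T=(0,\ell)\times(0,T)$; $h>0$ (tip length) and $\theta$ (half-conic angle) are given, and $c_\theta:=2h\cos\theta/\pi$. The coefficients satisfy $\rho_A,\mu,r,\kappa\in L^\infty(0,\ell)$ with constants $0<\rho_0\le\rho_A(x)\le\rho_1$, $0\le\mu_0\le\mu(x)\le\mu_1$, $0<r_0\le r(x)\le r_1$, $0<\kappa_0\le\kappa(x)\le\kappa_1$ for a.e. $x\in(0,\ell)$. The forward problem (P) for a shear force $g$ is \[ \rho_A(x)u_{tt}+\mu(x)u_t+\big(r(x)u_{xx}+\kappa(x)u_{xxt}\big)_{xx}=0\ \text{in }\Omega_T,\qquad u(x,0)=u_t(x,0)=0, \] \[ u(0,t)=u_x(0,t)=0,\quad \big(r u_{xx}+\kappa u_{xxt}\big)\big|_{x=\ell}=M(t),\quad -\big(r u_{xx}+\kappa u_{xxt}\big)_x\big|_{x=\ell}=g(t),\ t\in[0,T], \] with moment $M(t)=c_\theta\, g(t)$. Let $\mathcal V=\{v\in H^2(0,\ell): v(0)=v'(0)=0\}$. The weak solution of (P) is the (unique) function $u\in L^2(0,T;\mathcal V)$ with $u_t\in L^2(0,T;L^2(0,\ell))$, $u_{xxt}\in L^2(0,T;L^2(0,\ell))$, $u_{tt}\in L^2(0,T;H^{-2}(0,\ell))$, satisfying the zero initial conditions and, for a.e. $t$ and all $v\in\mathcal V$, $\langle\rho_A u_{tt},v\rangle+(\mu u_t,v)+(r u_{xx}+\kappa u_{xxt},v'')=M(t)v'(\ell)+g(t)v(\ell)$.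 *)

theory Defs
  imports "HOL-Analysis.Analysis"
begin

definition L2_on :: "'a::euclidean_space set \<Rightarrow> ('a \<Rightarrow> real) \<Rightarrow> bool" where
  "L2_on A f \<longleftrightarrow> set_borel_measurable lborel A f \<and> set_integrable lborel A (\<lambda>x. (f x)^2)"

definition L2ip :: "real \<Rightarrow> (real \<Rightarrow> real) \<Rightarrow> (real \<Rightarrow> real) \<Rightarrow> real" where
  "L2ip l f g = set_lebesgue_integral lborel {0..l} (\<lambda>x. f x * g x)"

text \<open>Membership in V = {v in H^2(0,l): v(0) = v'(0) = 0}, with second (weak) derivative v2:
  in one dimension this is exactly v(x) = int_0^x (x - s) v2(s) ds with v2 in L^2(0,l).\<close>
definition inV :: "real \<Rightarrow> (real \<Rightarrow> real) \<Rightarrow> (real \<Rightarrow> real) \<Rightarrow> bool" where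
  "inV l v v2 \<longleftrightarrow> L2_on {0..l} v2 \<and>
     (\<forall>x\<in>{0..l}. v x = set_lebesgue_integral lborel {0..x} (\<lambda>s. (x - s) * v2 s))"

text \<open>First derivative of v at l, v'(l) = int_0^l v2.\<close>
definition dV_end :: "real \<Rightarrow> (real \<Rightarrow> real) \<Rightarrow> real" where
  "dV_end l v2 = set_lebesgue_integral lborel {0..l} v2"

definition c_theta :: "real \<Rightarrow> real \<Rightarrow> real" where
  "c_theta h \<theta> = 2 * h * cos \<theta> / pi"

text \<open>Weak solution of (P): u, with u_t = ut, u_xx = uxx, u_xxt = uxxt (all functions of (x,t)).
  Regularity: u, u_xx, u_t, u_xxt in L^2(Omega_T); u(.,t) in V with second derivative uxx(.,t) for a.e. t;
  u_t and u_xxt are the weak time derivatives of u and u_xx with zero initial values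
  (u(t) = int_0^t u_t, u_xx(t) = int_0^t u_xxt);
  the variational identity with <rho_A u_tt, v> = d/dt (rho_A u_t, v) and u_t(0) = 0, in integrated form.\<close>
definition weak_solution ::
  "real \<Rightarrow> real \<Rightarrow> real \<Rightarrow> real \<Rightarrow> (real \<Rightarrow> real) \<Rightarrow> (real \<Rightarrow> real) \<Rightarrow> (real \<Rightarrow> real) \<Rightarrow> (real \<Rightarrow> real)
   \<Rightarrow> (real \<Rightarrow> real) \<Rightarrow> (real \<Rightarrow> real \<Rightarrow> real) \<Rightarrow> (real \<Rightarrow> real \<Rightarrow> real) \<Rightarrow> (real \<Rightarrow> real \<Rightarrow> real)
   \<Rightarrow> (real \<Rightarrow> real \<Rightarrow> real) \<Rightarrow> bool" where
  "weak_solution l T h \<theta> \<rho>A \<mu> r \<kappa> g u ut uxx uxxt \<longleftrightarrow>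
     L2_on ({0..l} \<times> {0..T}) (\<lambda>(x,t). u x t) \<and>
     L2_on ({0..l} \<times> {0..T}) (\<lambda>(x,t). uxx x t) \<and>
     L2_on ({0..l} \<times> {0..T}) (\<lambda>(x,t). ut x t) \<and>
     L2_on ({0..l} \<times> {0..T}) (\<lambda>(x,t). uxxt x t) \<and>
     (AE t in lborel. t \<in> {0..T} \<longrightarrow> inV l (\<lambda>x. u x t) (\<lambda>x. uxx x t)) \<and>
     (AE p in lborel. p \<in> {0..l} \<times> {0..T} \<longrightarrow>
        u (fst p) (snd p) = set_lebesgue_integral lborel {0..snd p} (\<lambda>s. ut (fst p) s)) \<and>
     (AE p in lborel. p \<in> {0..l} \<times> {0..T} \<longrightarrow>
        uxx (fst p) (snd p) = set_lebesgue_integral lborel {0..snd p} (\<lambda>s. uxxt (fst p) s)) \<and>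
     (\<forall>v v2. inV l v v2 \<longrightarrow>
        (AE t in lborel. t \<in> {0..T} \<longrightarrow>
           L2ip l (\<lambda>x. \<rho>A x * ut x t) v =
           set_lebesgue_integral lborel {0..t} (\<lambda>s.
              c_theta h \<theta> * g s * dV_end l v2 + g s * v l
              - L2ip l (\<lambda>x. \<mu> x * ut x s) v
              - L2ip l (\<lambda>x. r x * uxx x s + \<kappa> x * uxxt x s) v2)))"

end

theory Submission
  imports Defs
begin

text \<open>
  Since \<open>u\<^sub>t\<close> is not an admissible test function in the integrated weak form, the energy identity is
  obtained indirectly. Testing with \<open>v'' = 1\<^bsub>[0,q]\<^esub>\<close> for all \<open>q\<close> turns the weak form into a pointwise
  equation \<open>p(x,t) = \<integral>\<^sub>0\<^sup>t Q(x,s) ds\<close>. Here \<open>p\<close> is the momentum \<open>\<rho>\<^sub>A u\<^sub>t\<close> integrated twice from the free end,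
  so that \<open>(p(t), u\<^sub>x\<^sub>x\<^sub>t(s)) = (\<rho>\<^sub>A u\<^sub>t(t), u\<^sub>t(s))\<close> is symmetric in \<open>s, t\<close>, and \<open>Q\<close> collects load, damping and
  stress. With \<open>E = (\<rho>\<^sub>A u\<^sub>t, u\<^sub>t)\<close> the symmetry gives
  \<open>E(t+\<delta>) - E(t) = (p(t+\<delta>) - p(t), u\<^sub>x\<^sub>x\<^sub>t(t+\<delta>) + u\<^sub>x\<^sub>x\<^sub>t(t))\<close>.
  The difference quotients of \<open>p\<close> in time converge to \<open>Q\<close> in \<open>L\<^sup>2\<close>, by Lebesgue differentiation and
  Scheffe's lemma, so \<open>\<integral>\<^sub>0\<^sup>\<tau> E\<close> is differentiable with derivative \<open>2 \<integral>\<^sub>0\<^sup>\<tau> (Q, u\<^sub>x\<^sub>x\<^sub>t) dt\<close>, which is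
  therefore nonnegative. Integrating its load term by parts in time and applying Young's inequality
  yields \<open>y(\<tau>) \<le> A + \<integral>\<^sub>0\<^sup>\<tau> y\<close> for \<open>y = \<parallel>u\<^sub>x\<^sub>x\<parallel>\<^sup>2\<close>, and Gronwall's lemma finishes the proof.
\<close>

section \<open>Square integrable functions\<close>

definition square_integrable :: "'a measure \<Rightarrow> ('a \<Rightarrow> real) \<Rightarrow> bool" where
  "square_integrable M f \<longleftrightarrow> f \<in> borel_measurable M \<and> integrable M (\<lambda>x. (f x)\<^sup>2)"

lemma square_integrable_measurable [measurable_dest]:
  "square_integrable M f \<Longrightarrow> f \<in> borel_measurable M"
  by (simp add: square_integrable_def)

lemma square_integrableD: "square_integrable M f \<Longrightarrow> integrable M (\<lambda>x. (f x)\<^sup>2)"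
  by (simp add: square_integrable_def)

lemma integrable_if_abs_le:
  fixes f g :: "'a \<Rightarrow> real"
  assumes "integrable M g" "f \<in> borel_measurable M" "\<And>x. \<bar>f x\<bar> \<le> g x"
  shows "integrable M f"
  by (rule Bochner_Integration.integrable_bound[OF assms(1,2)])
     (use assms(3) in \<open>auto intro: order.trans[OF _ abs_ge_self]\<close>)

lemma square_integrable_if_abs_le:
  assumes "square_integrable M g" "f \<in> borel_measurable M" "\<And>x. \<bar>f x\<bar> \<le> \<bar>g x\<bar>"
  shows "square_integrable M f"
  unfolding square_integrable_def
proof
  show "integrable M (\<lambda>x. (f x)\<^sup>2)"
    by (rule integrable_if_abs_le[OF square_integrableD[OF assms(1)]])
       (use assms(2,3) in \<open>auto simp: abs_le_square_iff\<close>)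
qed fact

lemma square_integrable_cmult:
  "square_integrable M f \<Longrightarrow> square_integrable M (\<lambda>x. a * f x)"
  by (auto simp: square_integrable_def power_mult_distrib)

lemma square_integrable_bounded_mult:
  assumes [measurable]: "\<phi> \<in> borel_measurable M" and \<phi>: "\<And>x. \<bar>\<phi> x\<bar> \<le> C"
    and [measurable_dest]: "square_integrable M f"
  shows "square_integrable M (\<lambda>x. \<phi> x * f x)"
proof (rule square_integrable_if_abs_le[OF square_integrable_cmult[OF assms(3)]])
  show "\<bar>\<phi> x * f x\<bar> \<le> \<bar>C * f x\<bar>" for x
    using \<phi>[of x] by (auto simp: abs_mult intro!: mult_right_mono)
  show "(\<lambda>x. \<phi> x * f x) \<in> borel_measurable M"
    using assms(3) by measurable
qed

lemma two_mult_abs_le_sum_squares: "2 * \<bar>a * b\<bar> \<le> a\<^sup>2 + (b::real)\<^sup>2"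
  using sum_squares_bound[of "\<bar>a\<bar>" "\<bar>b\<bar>"] by (simp add: abs_mult)

lemma integrable_mult_square_integrable:
  assumes "square_integrable M f" "square_integrable M g"
  shows "integrable M (\<lambda>x. f x * g x)"
proof (rule integrable_if_abs_le)
  show "integrable M (\<lambda>x. (f x)\<^sup>2 + (g x)\<^sup>2)"
    using assms by (simp add: square_integrableD)
  show "(\<lambda>x. f x * g x) \<in> borel_measurable M"
    using assms by measurable
  show "\<bar>f x * g x\<bar> \<le> (f x)\<^sup>2 + (g x)\<^sup>2" for x
    using two_mult_abs_le_sum_squares[of "f x" "g x"] by linarith
qed

lemma square_integrable_add:
  assumes "square_integrable M f" "square_integrable M g"
  shows "square_integrable M (\<lambda>x. f x + g x)"
proof -
  have "integrable M (\<lambda>x. (f x)\<^sup>2 + (g x)\<^sup>2 + 2 * (f x * g x))"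
    using assms by (simp add: square_integrableD integrable_mult_square_integrable)
  moreover have "(\<lambda>x. f x + g x) \<in> borel_measurable M"
    using assms by measurable
  ultimately show ?thesis
    by (simp add: square_integrable_def power2_sum mult.assoc)
qed

lemma square_integrable_diff:
  assumes "square_integrable M f" "square_integrable M g"
  shows "square_integrable M (\<lambda>x. f x - g x)"
  using square_integrable_add[OF assms(1) square_integrable_cmult[OF assms(2), of "-1"]] by simp

lemma square_integrable_indicator:
  assumes "A \<in> sets M" "emeasure M A < \<infinity>"
  shows "square_integrable M (indicator A)"
  using assms by (simp add: square_integrable_def integrable_indicator_iff power2_eq_square
      flip: indicator_inter_arith)

lemma square_integrable_indicator_Icc:
  "square_integrable lborel (indicator {a..b} :: real \<Rightarrow> real)"
  by (rule square_integrable_indicator) (auto simp: emeasure_lborel_Icc_eq)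

lemma integrable_if_square_integrable:
  assumes f: "square_integrable M f" and "A \<in> sets M" "emeasure M A < \<infinity>"
    and supp: "\<And>x. x \<notin> A \<Longrightarrow> f x = 0"
  shows "integrable M f"
proof -
  have "(\<lambda>x. indicator A x * f x) = f"
    using supp by (auto simp: indicator_def fun_eq_iff)
  with integrable_mult_square_integrable[OF square_integrable_indicator[OF assms(2,3)] f]
  show ?thesis by simp
qed

lemma integrable_if_square_integrable_Icc:
  fixes f :: "real \<Rightarrow> real"
  assumes "square_integrable lborel f" "\<And>x. x \<notin> {a..b} \<Longrightarrow> f x = 0"
  shows "integrable lborel f"
  by (rule integrable_if_square_integrable[OF assms(1), of "{a..b}"])
     (use assms(2) in \<open>auto simp: emeasure_lborel_Icc_eq\<close>)

lemma Cauchy_Schwarz_integral_abs: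
  assumes f: "square_integrable M f" and g: "square_integrable M g"
  shows "(\<integral>x. \<bar>f x * g x\<bar> \<partial>M)\<^sup>2 \<le> (\<integral>x. (f x)\<^sup>2 \<partial>M) * (\<integral>x. (g x)\<^sup>2 \<partial>M)"
proof -
  let ?I = "\<integral>x. \<bar>f x * g x\<bar> \<partial>M"
  have [measurable]: "f \<in> borel_measurable M" "g \<in> borel_measurable M"
    using f g by measurable
  have nn_square: "(\<integral>\<^sup>+x. (ennreal \<bar>h x\<bar>)\<^sup>2 \<partial>M) = ennreal (\<integral>x. (h x)\<^sup>2 \<partial>M)"
    if "square_integrable M h" for h
    using square_integrableD[OF that]
    by (subst nn_integral_eq_integral[symmetric]) (auto simp: ennreal_power)
  have "integrable M (\<lambda>x. \<bar>f x * g x\<bar>)"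
    using integrable_mult_square_integrable[OF f g] by simp
  then have nn_prod: "ennreal ?I = (\<integral>\<^sup>+x. ennreal \<bar>f x\<bar> * ennreal \<bar>g x\<bar> \<partial>M)"
    by (subst nn_integral_eq_integral[symmetric]) (auto simp: abs_mult ennreal_mult)
  have "ennreal (?I\<^sup>2) = (\<integral>\<^sup>+x. ennreal \<bar>f x\<bar> * ennreal \<bar>g x\<bar> \<partial>M)\<^sup>2"
    by (simp add: ennreal_power flip: nn_prod)
  also have "\<dots> \<le> (\<integral>\<^sup>+x. (ennreal \<bar>f x\<bar>)\<^sup>2 \<partial>M) * (\<integral>\<^sup>+x. (ennreal \<bar>g x\<bar>)\<^sup>2 \<partial>M)"
    by (rule Cauchy_Schwarz_nn_integral) auto
  finally show ?thesis
    by (simp add: nn_square[OF f] nn_square[OF g] flip: ennreal_mult)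
qed

lemma Cauchy_Schwarz_integral:
  assumes "square_integrable M f" "square_integrable M g"
  shows "(\<integral>x. f x * g x \<partial>M)\<^sup>2 \<le> (\<integral>x. (f x)\<^sup>2 \<partial>M) * (\<integral>x. (g x)\<^sup>2 \<partial>M)"
proof -
  have "\<bar>\<integral>x. f x * g x \<partial>M\<bar>\<^sup>2 \<le> (\<integral>x. \<bar>f x * g x\<bar> \<partial>M)\<^sup>2"
    by (intro power_mono integral_abs_bound) auto
  with Cauchy_Schwarz_integral_abs[OF assms] show ?thesis by simp
qed

lemma square_integral_supported_le:
  assumes f: "square_integrable M f" and A: "A \<in> sets M" "emeasure M A < \<infinity>"
    and supp: "\<And>x. x \<notin> A \<Longrightarrow> f x = 0"
  shows "(\<integral>x. f x \<partial>M)\<^sup>2 \<le> measure M A * (\<integral>x. (f x)\<^sup>2 \<partial>M)"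
proof -
  have f_eq: "(\<lambda>x. indicator A x * f x) = f"
    using supp by (auto simp: indicator_def fun_eq_iff)
  have "(\<lambda>x. (indicator A x)\<^sup>2) = (indicator A :: _ \<Rightarrow> real)"
    by (auto simp: indicator_def fun_eq_iff)
  moreover have "A \<inter> space M = A"
    using sets.sets_into_space[OF A(1)] by blast
  ultimately show ?thesis
    using Cauchy_Schwarz_integral[OF square_integrable_indicator[OF A] f] unfolding f_eq by simp
qed

lemma square_integral_Icc_supported_le:
  fixes f :: "real \<Rightarrow> real"
  assumes "square_integrable lborel f" "\<And>x. x \<notin> {a..b} \<Longrightarrow> f x = 0" "a \<le> b"
  shows "(\<integral>x. f x \<partial>lborel)\<^sup>2 \<le> (b - a) * (\<integral>x. (f x)\<^sup>2 \<partial>lborel)"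
  using square_integral_supported_le[OF assms(1), of "{a..b}"] assms(2,3)
  by (simp add: emeasure_lborel_Icc_eq)

lemma integrable_sign_square:
  assumes "square_integrable M f"
  shows "integrable M (\<lambda>x. f x * \<bar>f x\<bar>)"
proof -
  have "square_integrable M (\<lambda>x. \<bar>f x\<bar>)" 
    by (rule square_integrable_if_abs_le[OF assms]) (use assms in measurable)
  then show ?thesis by (rule integrable_mult_square_integrable[OF assms])
qed

lemma square_diff_le_sign_square: "(a - b)\<^sup>2 \<le> 2 * \<bar>a * \<bar>a\<bar> - b * \<bar>b\<bar>\<bar>" for a b :: real
proof (cases "0 \<le> a * b")
  case True
  then have "\<bar>a * \<bar>a\<bar> - b * \<bar>b\<bar>\<bar> = \<bar>a - b\<bar> * \<bar>a + b\<bar>"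
    by (auto simp: zero_le_mult_iff abs_mult[symmetric] algebra_simps)
  moreover have "\<bar>a - b\<bar> \<le> \<bar>a + b\<bar>"
    using True by (auto simp: zero_le_mult_iff)
  then have "\<bar>a - b\<bar> * \<bar>a - b\<bar> \<le> \<bar>a - b\<bar> * \<bar>a + b\<bar>"
    by (rule mult_left_mono) simp
  ultimately show ?thesis
    by (simp add: power2_eq_square)
next
  case False
  then have "a * \<bar>a\<bar> - b * \<bar>b\<bar> = a\<^sup>2 + b\<^sup>2 \<or> a * \<bar>a\<bar> - b * \<bar>b\<bar> = - (a\<^sup>2 + b\<^sup>2)"
    by (auto simp: zero_le_mult_iff power2_eq_square not_le)
  then have "\<bar>a * \<bar>a\<bar> - b * \<bar>b\<bar>\<bar> = a\<^sup>2 + b\<^sup>2"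
    by (elim disjE) simp_all
  moreover have "0 \<le> (a + b)\<^sup>2" by simp
  ultimately show ?thesis
    by (simp add: power2_sum power2_diff)
qed

text \<open>The map \<open>f \<mapsto> f\<bar>f\<bar>\<close> carries \<open>L\<^sup>2\<close> to \<open>L\<^sup>1\<close>, where Scheffe's lemma applies.\<close>

lemma Scheffe_square:
  assumes f: "square_integrable M f" and F: "\<And>n. square_integrable M (F n)"
    and lim: "AE x in M. (\<lambda>n. F n x) \<longlonglongrightarrow> f x"
    and norm_le: "\<And>n. (\<integral>x. (F n x)\<^sup>2 \<partial>M) \<le> (\<integral>x. (f x)\<^sup>2 \<partial>M)"
  shows "(\<lambda>n. \<integral>x. (F n x - f x)\<^sup>2 \<partial>M) \<longlonglongrightarrow> 0"
proof -
  let ?s = "\<lambda>h x. h x * \<bar>h x :: real\<bar>"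
  have nn_norm: "(\<integral>\<^sup>+x. norm (?s h x) \<partial>M) = ennreal (\<integral>x. (h x)\<^sup>2 \<partial>M)" if "square_integrable M h" for h
    using square_integrableD[OF that]
    by (subst nn_integral_eq_integral[symmetric]) (auto simp: abs_mult power2_eq_square)
  have int: "integrable M (\<lambda>x. \<bar>?s (F n) x - ?s f x\<bar>)" for n
    using integrable_sign_square[OF f] integrable_sign_square[OF F] by simp
  have "(\<lambda>n. \<integral>\<^sup>+x. norm (?s (F n) x - ?s f x) \<partial>M) \<longlonglongrightarrow> 0"
  proof (rule Scheffe_lemma2)
    show "?s (F n) \<in> borel_measurable M" for n
      using F[of n] by measurable
    show "integrable M (?s f)" by (rule integrable_sign_square[OF f])
    show "AE x in M. (\<lambda>n. ?s (F n) x) \<longlonglongrightarrow> ?s f x"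
      using lim by eventually_elim (intro tendsto_intros)
    show "(\<integral>\<^sup>+x. norm (?s (F n) x) \<partial>M) \<le> (\<integral>\<^sup>+x. norm (?s f x) \<partial>M)" for n
      using norm_le[of n] by (simp only: nn_norm[OF F] nn_norm[OF f] ennreal_leI)
  qed
  also have "(\<lambda>n. \<integral>\<^sup>+x. norm (?s (F n) x - ?s f x) \<partial>M) = (\<lambda>n. ennreal (\<integral>x. \<bar>?s (F n) x - ?s f x\<bar> \<partial>M))"
    using int by (simp add: nn_integral_eq_integral)
  finally have L1: "(\<lambda>n. \<integral>x. \<bar>?s (F n) x - ?s f x\<bar> \<partial>M) \<longlonglongrightarrow> 0"
    by (subst (asm) ennreal_0[symmetric], subst (asm) tendsto_ennreal_iff) auto
  have "(\<integral>x. (F n x - f x)\<^sup>2 \<partial>M) \<le> 2 * (\<integral>x. \<bar>?s (F n) x - ?s f x\<bar> \<partial>M)" for n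
  proof -
    have "(\<integral>x. (F n x - f x)\<^sup>2 \<partial>M) \<le> (\<integral>x. 2 * \<bar>?s (F n) x - ?s f x\<bar> \<partial>M)"
      by (rule integral_mono)
         (use int[of n] square_integrableD[OF square_integrable_diff[OF F f]]
           square_diff_le_sign_square in auto)
    then show ?thesis by simp
  qed
  then show ?thesis
    by (intro Lim_null_comparison[OF _ tendsto_mult_right_zero[OF L1]] always_eventually allI) simp
qed

lemma tendsto_integral_abs_mult_L2:
  assumes f: "square_integrable M f" "\<And>n. square_integrable M (F n)"
    and g: "square_integrable M g"
    and lim: "(\<lambda>n. \<integral>x. (F n x - f x)\<^sup>2 \<partial>M) \<longlonglongrightarrow> 0"
  shows "(\<lambda>n. \<integral>x. \<bar>(F n x - f x) * g x\<bar> \<partial>M) \<longlonglongrightarrow> 0"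
proof -
  have "(\<lambda>n. sqrt ((\<integral>x. (F n x - f x)\<^sup>2 \<partial>M) * (\<integral>x. (g x)\<^sup>2 \<partial>M))) \<longlonglongrightarrow> 0"
    using tendsto_real_sqrt[OF tendsto_mult_left_zero[OF lim]] by simp
  then show ?thesis
  proof (rule Lim_null_comparison[rotated])
    have "(\<integral>x. \<bar>(F n x - f x) * g x\<bar> \<partial>M) \<le> sqrt ((\<integral>x. (F n x - f x)\<^sup>2 \<partial>M) * (\<integral>x. (g x)\<^sup>2 \<partial>M))" for n
      by (rule real_le_rsqrt[OF Cauchy_Schwarz_integral_abs[OF square_integrable_diff[OF f(2,1)] g]])
    then show "\<forall>\<^sub>F n in sequentially. norm (\<integral>x. \<bar>(F n x - f x) * g x\<bar> \<partial>M)
        \<le> sqrt ((\<integral>x. (F n x - f x)\<^sup>2 \<partial>M) * (\<integral>x. (g x)\<^sup>2 \<partial>M))"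
      by simp
  qed
qed

section \<open>Primitives on the line\<close>

definition primitive :: "(real \<Rightarrow> real) \<Rightarrow> real \<Rightarrow> real" where
  "primitive f t = (LBINT s:{..t}. f s)"

lemma primitive_measurable [measurable]:
  fixes f :: "'a \<Rightarrow> real \<Rightarrow> real"
  assumes [measurable]: "case_prod f \<in> borel_measurable (M \<Otimes>\<^sub>M borel)" "h \<in> borel_measurable M"
  shows "(\<lambda>x. primitive (f x) (h x)) \<in> borel_measurable M"
proof -
  have "(\<lambda>x. \<integral>s. (if s \<le> h x then 1 else 0) *\<^sub>R f x s \<partial>lborel) \<in> borel_measurable M"
    by measurable
  then show ?thesis
    by (simp add: primitive_def set_lebesgue_integral_def indicator_def)
qed

lemma set_integrable_lborel:
  fixes f :: "'a::euclidean_space \<Rightarrow> real"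
  shows "integrable lborel f \<Longrightarrow> A \<in> sets borel \<Longrightarrow> set_integrable lborel A f"
  unfolding set_integrable_def by (rule integrable_mult_indicator) simp_all

lemma integral_lborel_shift: "(\<integral>t. f (t + \<delta>) \<partial>lborel) = (\<integral>t. f t \<partial>lborel)"
  for f :: "real \<Rightarrow> real"
  using lborel_integral_real_affine[of 1 f \<delta>] by (simp add: add.commute)

lemma integrable_lborel_shift:
  fixes f :: "real \<Rightarrow> real"
  shows "integrable lborel f \<Longrightarrow> integrable lborel (\<lambda>t. f (t + \<delta>))"
  using lborel_integrable_real_affine[of f 1 \<delta>] by (simp add: add.commute)

lemma primitive_add:
  "integrable lborel f \<Longrightarrow> integrable lborel g \<Longrightarrow>
    primitive (\<lambda>s. f s + g s) t = primitive f t + primitive g t"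
  by (simp add: primitive_def set_integrable_lborel)

lemma primitive_diff:
  "integrable lborel f \<Longrightarrow> integrable lborel g \<Longrightarrow>
    primitive (\<lambda>s. f s - g s) t = primitive f t - primitive g t"
  by (simp add: primitive_def set_integrable_lborel)

lemma primitive_cmult: "primitive (\<lambda>s. c * f s) t = c * primitive f t"
  by (simp add: primitive_def)

lemma primitive_0 [simp]: "primitive (\<lambda>_. 0) t = 0"
  by (simp add: primitive_def)

lemma primitive_cong:
  assumes "\<And>s. s \<le> t \<Longrightarrow> f s = g s"
  shows "primitive f t = primitive g t"
  unfolding primitive_def by (rule set_lebesgue_integral_cong) (use assms in auto)

lemma primitive_cong_AE:
  assumes [measurable]: "f \<in> borel_measurable borel" "g \<in> borel_measurable borel"
    and "AE s in lborel. s \<le> t \<longrightarrow> f s = g s"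
  shows "primitive f t = primitive g t"
  unfolding primitive_def by (rule set_lebesgue_integral_cong_AE) (use assms(3) in auto)

lemma primitive_mono:
  assumes "integrable lborel f" "integrable lborel g" "\<And>s. s \<le> t \<Longrightarrow> f s \<le> g s"
  shows "primitive f t \<le> primitive g t"
  unfolding primitive_def by (rule set_integral_mono) (use assms in \<open>auto intro: set_integrable_lborel\<close>)

lemma abs_primitive_le:
  assumes "integrable lborel f"
  shows "\<bar>primitive f t\<bar> \<le> (\<integral>s. \<bar>f s\<bar> \<partial>lborel)"
proof -
  have "\<bar>primitive f t\<bar> \<le> (\<integral>s. \<bar>indicator {..t} s *\<^sub>R f s\<bar> \<partial>lborel)"
    unfolding primitive_def set_lebesgue_integral_def by (rule integral_abs_bound)
  also have "\<dots> \<le> (\<integral>s. \<bar>f s\<bar> \<partial>lborel)"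
    using set_integrable_lborel[OF assms, of "{..t}"] assms
    by (intro integral_mono) (auto simp: set_integrable_def indicator_def)
  finally show ?thesis .
qed

lemma primitive_eq_LBINT_Icc:
  assumes "\<And>s. s < a \<Longrightarrow> f s = 0"
  shows "primitive f t = (LBINT s:{a..t}. f s)"
  unfolding primitive_def set_lebesgue_integral_def
  by (rule Bochner_Integration.integral_cong) (use assms in \<open>auto simp: indicator_def not_le\<close>)

lemma primitive_eq_integral:
  assumes "\<And>s. b < s \<Longrightarrow> f s = 0" "b \<le> t"
  shows "primitive f t = (\<integral>s. f s \<partial>lborel)"
  unfolding primitive_def set_lebesgue_integral_def
  by (rule Bochner_Integration.integral_cong)
     (use assms in \<open>auto simp: indicator_def not_le\<close>)

lemma primitive_shift: "primitive (\<lambda>s. f (s + \<delta>)) t = primitive f (t + \<delta>)"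
proof -
  have "primitive f (t + \<delta>) = (\<integral>s. indicator {..t + \<delta>} (s + \<delta>) *\<^sub>R f (s + \<delta>) \<partial>lborel)"
    unfolding primitive_def set_lebesgue_integral_def by (rule integral_lborel_shift[symmetric])
  then show ?thesis
    by (simp add: primitive_def set_lebesgue_integral_def indicator_def)
qed

lemma primitive_increment:
  assumes f: "integrable lborel f" and "a \<le> b"
  shows "primitive f b - primitive f a = integral {a..b} f"
proof -
  have [measurable]: "f \<in> borel_measurable borel" using f by auto
  have int: "integrable lborel (\<lambda>s. indicator {..c} s *\<^sub>R f s)" for c
    using set_integrable_lborel[OF f, of "{..c}"] by (simp add: set_integrable_def)
  have "primitive f b - primitive f a = (\<integral>s. indicator {..b} s *\<^sub>R f s - indicator {..a} s *\<^sub>R f s \<partial>lborel)"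
    using int by (simp add: primitive_def set_lebesgue_integral_def)
  also have "\<dots> = (LBINT s:{a..b}. f s)"
    unfolding set_lebesgue_integral_def
  proof (rule integral_cong_AE)
    show "AE s in lborel. indicator {..b} s *\<^sub>R f s - indicator {..a} s *\<^sub>R f s = indicator {a..b} s *\<^sub>R f s"
      using AE_lborel_singleton[of a] by eventually_elim (use \<open>a \<le> b\<close> in \<open>auto simp: indicator_def\<close>)
  qed measurable
  also have "\<dots> = integral {a..b} f"
    by (rule set_borel_integral_eq_integral(2)[OF set_integrable_lborel[OF f]]) simp
  finally show ?thesis .
qed

lemma isCont_primitive:
  assumes f: "integrable lborel f"
  shows "isCont (primitive f) t"
  unfolding continuous_at_sequentially comp_def
proof (intro allI impI)
  fix X assume X: "X \<longlonglongrightarrow> t"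
  have [measurable]: "f \<in> borel_measurable borel" using f by auto
  show "(\<lambda>n. primitive f (X n)) \<longlonglongrightarrow> primitive f t"
    unfolding primitive_def set_lebesgue_integral_def
  proof (rule integral_dominated_convergence[where w="\<lambda>s. \<bar>f s\<bar>"])
    show "AE s in lborel. (\<lambda>n. indicator {..X n} s *\<^sub>R f s) \<longlonglongrightarrow> indicator {..t} s *\<^sub>R f s"
      using AE_lborel_singleton[of t]
    proof eventually_elim
      case (elim s)
      have "\<forall>\<^sub>F n in sequentially. s \<le> X n \<longleftrightarrow> s \<le> t"
      proof (cases "s < t")
        case True
        from order_tendstoD(1)[OF X this] show ?thesis
          by eventually_elim (use True in auto)
      next
        case False
        then have "t < s" using elim by auto
        from order_tendstoD(2)[OF X this] show ?thesis
          by eventually_elim (use \<open>t < s\<close> in auto)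
      qed
      then have "\<forall>\<^sub>F n in sequentially. indicator {..X n} s *\<^sub>R f s = indicator {..t} s *\<^sub>R f s"
        by eventually_elim (auto simp: indicator_def)
      then show ?case by (rule tendsto_eventually)
    qed
  qed (use f in \<open>auto simp: indicator_def\<close>)
qed

lemma tendsto_right_difference_quotient_primitive:
  assumes f: "integrable lborel f"
  shows "AE t in lborel. ((\<lambda>h. (primitive f (t + h) - primitive f t) / h) \<longlongrightarrow> f t) (at_right 0)"
proof -
  have "f integrable_on cbox a b" for a b
    using set_borel_integral_eq_integral(1)[OF set_integrable_lborel[OF f]] by simp
  from integrable_ccontinuous_explicit[OF this] obtain N where N: "negligible N"
    and mean: "\<And>t e. t \<notin> N \<Longrightarrow> 0 < e \<Longrightarrow>
      \<exists>d>0. \<forall>h. 0 < h \<and> h < d \<longrightarrow> norm (integral (cbox t (t + h *\<^sub>R One)) f /\<^sub>R h ^ DIM(real) - f t) < e"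
    by metis
  have "AE t in lborel. t \<notin> N"
    using N by (subst AE_completion_iff[symmetric]) (auto simp: negligible_iff_null_sets AE_not_in)
  then show ?thesis
  proof eventually_elim
    case (elim t)
    show ?case
    proof (rule tendstoI)
      fix e :: real assume "0 < e"
      from mean[OF elim this] obtain d where "d > 0"
        and d: "\<And>h. 0 < h \<Longrightarrow> h < d \<Longrightarrow> \<bar>integral {t..t + h} f / h - f t\<bar> < e"
        by (auto simp: divide_inverse mult.commute)
      show "\<forall>\<^sub>F h in at_right 0. dist ((primitive f (t + h) - primitive f t) / h) (f t) < e"
        unfolding eventually_at_right_field
        using \<open>d > 0\<close> d by (intro exI[of _ d]) (auto simp: dist_real_def primitive_increment[OF f])
    qed
  qed
qed

lemma AE_has_real_derivative_primitive:
  assumes f: "integrable lborel f"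
  shows "AE t in lborel. (primitive f has_real_derivative f t) (at t)"
proof -
  let ?g = "\<lambda>s. f (- s)"
  have g: "integrable lborel ?g"
    using lborel_integrable_real_affine[OF f, of "-1" 0] by simp
  have reflect: "primitive ?g (h - t) - primitive ?g (- t) = primitive f t - primitive f (t - h)"
    if "h > 0" for t h
    using that Henstock_Kurzweil_Integration.integral_reflect_real[of t "t - h" f]
    by (simp add: primitive_increment[OF f] primitive_increment[OF g])
  have "AE t in distr lborel borel uminus.
      ((\<lambda>h. (primitive ?g (t + h) - primitive ?g t) / h) \<longlongrightarrow> ?g t) (at_right 0)"
    using tendsto_right_difference_quotient_primitive[OF g] by (subst lborel_distr_uminus)
  then have "AE t in lborel. ((\<lambda>h. (primitive ?g (- t + h) - primitive ?g (- t)) / h) \<longlongrightarrow> ?g (- t)) (at_right 0)"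
    by (rule AE_distrD[rotated]) simp
  with tendsto_right_difference_quotient_primitive[OF f] show ?thesis
  proof eventually_elim
    case (elim t)
    have "((\<lambda>h. (primitive f (t - h) - primitive f t) / (- h)) \<longlongrightarrow> f t) (at_right 0)"
    proof (rule Lim_transform_eventually)
      show "\<forall>\<^sub>F h in at_right 0. (primitive ?g (- t + h) - primitive ?g (- t)) / h
          = (primitive f (t - h) - primitive f t) / (- h)"
        using eventually_at_right_less
        by eventually_elim (simp add: reflect minus_divide_left flip: minus_divide_right)
    qed (use elim(2) in simp)
    then have "((\<lambda>h. (primitive f (t + h) - primitive f t) / h) \<longlongrightarrow> f t) (at_left 0)"
      by (simp add: filterlim_at_left_to_right)
    with elim(1) show ?case
      by (simp add: DERIV_def filterlim_at_split)
  qed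
qed

lemma AE_eq_0_if_AE_primitive_eq_0:
  assumes f: "integrable lborel f" and zero: "AE t in lborel. t \<in> {a..b} \<longrightarrow> primitive f t = 0"
  shows "AE t in lborel. t \<in> {a..b} \<longrightarrow> f t = 0"
proof -
  let ?S = "{t \<in> {a<..<b}. primitive f t \<noteq> 0}"
  have "continuous_on UNIV (primitive f)"
    by (simp add: continuous_at_imp_continuous_on isCont_primitive[OF f])
  then have "open ({a<..<b} \<inter> {t. primitive f t \<noteq> 0})"
    by (intro open_Int open_Collect_neq continuous_intros) auto
  moreover have "{a<..<b} \<inter> {t. primitive f t \<noteq> 0} = ?S"
    by auto
  ultimately have "open ?S" by simp
  have "AE t in lborel. t \<notin> ?S" using zero by eventually_elim auto
  then have "?S \<in> null_sets lborel"
    using \<open>open ?S\<close> AE_iff_null_sets[of ?S lborel] by simp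
  then have "negligible ?S"
    by (simp only: negligible_iff_null_sets null_sets_completionI)
  then have zero_everywhere: "primitive f t = 0" if "t \<in> {a<..<b}" for t
    using open_not_negligible[OF \<open>open ?S\<close>] that by blast
  show ?thesis
    using AE_has_real_derivative_primitive[OF f] AE_lborel_singleton[of a] AE_lborel_singleton[of b]
  proof eventually_elim
    case (elim t)
    have "f t = 0" if "t \<in> {a<..<b}"
    proof (rule DERIV_unique[OF elim(1)])
      show "(primitive f has_real_derivative 0) (at t)"
        by (rule has_field_derivative_transform_within_open[of "\<lambda>_. 0" _ _ "{a<..<b}"])
           (use that zero_everywhere in auto)
    qed
    with elim show ?case by auto
  qed
qed

lemma square_primitive_le:
  assumes f: "square_integrable lborel f" and supp: "\<And>s. s \<notin> {a..b} \<Longrightarrow> f s = 0" and "a \<le> b"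
  shows "(primitive f t)\<^sup>2 \<le> (b - a) * (\<integral>s. (f s)\<^sup>2 \<partial>lborel)"
proof -
  let ?g = "\<lambda>s. indicator {..t} s * f s"
  have g: "square_integrable lborel ?g"
    by (rule square_integrable_bounded_mult[OF _ _ f, of _ 1]) auto
  have "(primitive f t)\<^sup>2 \<le> (b - a) * (\<integral>s. (?g s)\<^sup>2 \<partial>lborel)"
    unfolding primitive_def set_lebesgue_integral_def real_scaleR_def
    by (rule square_integral_Icc_supported_le[OF g _ \<open>a \<le> b\<close>]) (use supp in auto)
  also have "\<dots> \<le> (b - a) * (\<integral>s. (f s)\<^sup>2 \<partial>lborel)"
    using \<open>a \<le> b\<close> g f by (intro mult_left_mono integral_mono) (auto simp: square_integrableD indicator_def)
  finally show ?thesis .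
qed

lemma integrable_pair_mult:
  fixes a :: "'a::euclidean_space \<Rightarrow> real" and b :: "'b::euclidean_space \<Rightarrow> real"
  assumes a: "integrable lborel a" and b: "integrable lborel b"
  shows "integrable (lborel \<Otimes>\<^sub>M lborel) (\<lambda>(x, y). a x * b y)"
proof (rule lborel_pair.Fubini_integrable)
  have [measurable]: "a \<in> borel_measurable borel" "b \<in> borel_measurable borel" using a b by auto
  show "(\<lambda>(x, y). a x * b y) \<in> borel_measurable (lborel \<Otimes>\<^sub>M lborel)" by measurable
  show "integrable lborel (\<lambda>x. \<integral>y. norm (case (x, y) of (x, y) \<Rightarrow> a x * b y) \<partial>lborel)"
    using a b by (simp add: abs_mult)
  show "AE x in lborel. integrable lborel (\<lambda>y. case (x, y) of (x, y) \<Rightarrow> a x * b y)"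
    using b by simp
qed

lemma integral_kernel_adjoint:
  fixes a :: "'a::euclidean_space \<Rightarrow> real" and b :: "'b::euclidean_space \<Rightarrow> real" and k :: "'a \<Rightarrow> 'b \<Rightarrow> real"
  assumes a: "integrable lborel a" and b: "integrable lborel b"
    and [measurable]: "case_prod k \<in> borel_measurable (borel \<Otimes>\<^sub>M borel)" and k: "\<And>x y. \<bar>k x y\<bar> \<le> C"
  shows "(\<integral>x. a x * (\<integral>y. k x y * b y \<partial>lborel) \<partial>lborel) = (\<integral>y. (\<integral>x. k x y * a x \<partial>lborel) * b y \<partial>lborel)"
proof -
  have [measurable]: "a \<in> borel_measurable borel" "b \<in> borel_measurable borel" using a b by auto
  have "integrable (lborel \<Otimes>\<^sub>M lborel) (\<lambda>(x, y). C * (\<bar>a x\<bar> * \<bar>b y\<bar>))"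
    using integrable_pair_mult[of "\<lambda>x. \<bar>a x\<bar>" "\<lambda>y. \<bar>b y\<bar>"] a b by (simp add: case_prod_unfold)
  then have int: "integrable (lborel \<Otimes>\<^sub>M lborel) (\<lambda>(x, y). a x * (k x y * b y))"
  proof (rule integrable_if_abs_le)
    show "\<bar>case z of (x, y) \<Rightarrow> a x * (k x y * b y)\<bar> \<le> (case z of (x, y) \<Rightarrow> C * (\<bar>a x\<bar> * \<bar>b y\<bar>))" for z
      using mult_right_mono[OF k[of "fst z" "snd z"], of "\<bar>a (fst z)\<bar> * \<bar>b (snd z)\<bar>"]
      by (auto simp: case_prod_unfold abs_mult mult_ac)
  qed measurable
  have "(\<integral>x. a x * (\<integral>y. k x y * b y \<partial>lborel) \<partial>lborel) = (\<integral>x. (\<integral>y. a x * (k x y * b y) \<partial>lborel) \<partial>lborel)"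
    by simp
  also have "\<dots> = (\<integral>y. (\<integral>x. a x * (k x y * b y) \<partial>lborel) \<partial>lborel)"
    by (rule lborel_pair.Fubini_integral[OF int, symmetric])
  also have "\<dots> = (\<integral>y. (\<integral>x. (k x y * a x) * b y \<partial>lborel) \<partial>lborel)"
    by (simp add: mult_ac)
  finally show ?thesis by simp
qed

lemma integrable_mult_primitive:
  assumes f: "integrable lborel f" and g: "integrable lborel g"
  shows "integrable lborel (\<lambda>t. f t * primitive g t)"
proof (rule integrable_if_abs_le)
  have [measurable]: "f \<in> borel_measurable borel" "g \<in> borel_measurable borel" using f g by auto
  show "integrable lborel (\<lambda>t. \<bar>f t\<bar> * (\<integral>s. \<bar>g s\<bar> \<partial>lborel))"
    using f by simp
  show "(\<lambda>t. f t * primitive g t) \<in> borel_measurable lborel" by measurable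
  show "\<bar>f t * primitive g t\<bar> \<le> \<bar>f t\<bar> * (\<integral>s. \<bar>g s\<bar> \<partial>lborel)" for t
    unfolding abs_mult by (intro mult_left_mono abs_primitive_le g) simp
qed

lemma integral_kernel_before:
  assumes [measurable]: "g \<in> borel_measurable borel" and "s \<le> \<tau>"
  shows "(\<integral>t. (if t < s then 1 else 0) * (indicator {..\<tau>} t * g t) \<partial>lborel) = primitive g s"
  unfolding primitive_def set_lebesgue_integral_def
proof (rule integral_cong_AE)
  show "AE t in lborel. (if t < s then 1 else 0) * (indicator {..\<tau>} t * g t) = indicator {..s} t *\<^sub>R g t"
    using AE_lborel_singleton[of s] by eventually_elim (use \<open>s \<le> \<tau>\<close> in \<open>auto simp: indicator_def\<close>)
qed measurable

lemma integral_kernel_after: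
  assumes f: "integrable lborel f" and "t \<le> \<tau>"
  shows "(\<integral>s. (if t < s then 1 else 0) * (indicator {..\<tau>} s * f s) \<partial>lborel) = primitive f \<tau> - primitive f t"
proof -
  have "primitive f \<tau> - primitive f t = (\<integral>s. indicator {..\<tau>} s * f s - indicator {..t} s * f s \<partial>lborel)"
    using set_integrable_lborel[OF f, of "{..t}"] set_integrable_lborel[OF f, of "{..\<tau>}"]
    by (simp add: primitive_def set_lebesgue_integral_def set_integrable_def)
  also have "\<dots> = (\<integral>s. (if t < s then 1 else 0) * (indicator {..\<tau>} s * f s) \<partial>lborel)"
    by (rule Bochner_Integration.integral_cong) (use \<open>t \<le> \<tau>\<close> in \<open>auto simp: indicator_def\<close>)
  finally show ?thesis by simp
qed

lemma primitive_by_parts: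
  assumes f: "integrable lborel f" and g: "integrable lborel g"
  shows "primitive f \<tau> * primitive g \<tau>
    = primitive (\<lambda>t. primitive f t * g t) \<tau> + primitive (\<lambda>t. f t * primitive g t) \<tau>"
proof -
  let ?f = "\<lambda>s. indicator {..\<tau>} s * f s" and ?g = "\<lambda>t. indicator {..\<tau>} t * g t"
  let ?k = "\<lambda>s t. if t < s then 1 else 0 :: real"
  have fg: "integrable lborel ?f" "integrable lborel ?g"
    using set_integrable_lborel[OF f, of "{..\<tau>}"] set_integrable_lborel[OF g, of "{..\<tau>}"]
    by (simp_all add: set_integrable_def)
  have [measurable]: "g \<in> borel_measurable borel" using g by auto
  have "primitive (\<lambda>s. f s * primitive g s) \<tau> = (\<integral>s. ?f s * (\<integral>t. ?k s t * ?g t \<partial>lborel) \<partial>lborel)"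
    unfolding primitive_def[of "\<lambda>s. f s * primitive g s"] set_lebesgue_integral_def
  proof (rule Bochner_Integration.integral_cong[OF refl])
    show "indicator {..\<tau>} s *\<^sub>R (f s * primitive g s) = ?f s * (\<integral>t. ?k s t * ?g t \<partial>lborel)" for s
      by (cases "s \<le> \<tau>") (simp_all add: integral_kernel_before)
  qed
  also have "\<dots> = (\<integral>t. (\<integral>s. ?k s t * ?f s \<partial>lborel) * ?g t \<partial>lborel)"
    by (rule integral_kernel_adjoint[OF fg, of _ 1]) auto
  also have "\<dots> = primitive (\<lambda>t. primitive f \<tau> * g t - primitive f t * g t) \<tau>"
    unfolding primitive_def[of "\<lambda>t. primitive f \<tau> * g t - primitive f t * g t"] set_lebesgue_integral_def
  proof (rule Bochner_Integration.integral_cong[OF refl])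
    show "(\<integral>s. ?k s t * ?f s \<partial>lborel) * ?g t
        = indicator {..\<tau>} t *\<^sub>R (primitive f \<tau> * g t - primitive f t * g t)" for t
      by (cases "t \<le> \<tau>") (simp_all add: integral_kernel_after[OF f] left_diff_distrib)
  qed
  also have "\<dots> = primitive f \<tau> * primitive g \<tau> - primitive (\<lambda>t. primitive f t * g t) \<tau>"
    using g integrable_mult_primitive[OF g f]
    by (simp add: primitive_diff primitive_cmult mult.commute[of "g _"])
  finally show ?thesis by simp
qed

subsection \<open>Gronwall's inequality\<close>

lemma nonincreasing_if_derivative_within_nonpos:
  fixes f :: "real \<Rightarrow> real"
  assumes "a \<le> b"
    and der: "\<And>x. x \<in> {a..b} \<Longrightarrow> (f has_real_derivative f' x) (at x within {a..b})"
    and nonpos: "\<And>x. x \<in> {a..b} \<Longrightarrow> f' x \<le> 0"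
  shows "f b \<le> f a"
proof (rule DERIV_nonpos_imp_decreasing_open[where f=f, OF \<open>a \<le> b\<close>])
  show "continuous_on {a..b} f"
    by (rule DERIV_continuous_on[OF der])
  show "\<exists>y. (f has_real_derivative y) (at x) \<and> y \<le> 0" if "a < x" "x < b" for x
    using der[of x] nonpos[of x] that by (auto simp: at_within_Icc_at)
qed

lemma Gronwall_continuous:
  fixes z :: "real \<Rightarrow> real"
  assumes cont: "continuous_on {0..T} z"
    and bound: "\<And>t. t \<in> {0..T} \<Longrightarrow> z t \<le> A + integral {0..t} z" and t: "t \<in> {0..T}"
  shows "z t \<le> A * exp t"
proof -
  let ?I = "\<lambda>s. A + integral {0..s} z"
  have "?I t * exp (- t) \<le> ?I 0 * exp (- 0)"
  proof (rule nonincreasing_if_derivative_within_nonpos[of 0 t "\<lambda>s. ?I s * exp (- s)"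
        "\<lambda>s. (z s - ?I s) * exp (- s)"])
    fix s assume s: "s \<in> {0..t}"
    have "((\<lambda>s. integral {0..s} z) has_real_derivative z s) (at s within {0..t})"
      using cont s t by (intro integral_has_real_derivative) (auto intro: continuous_on_subset)
    then show "((\<lambda>s. ?I s * exp (- s)) has_real_derivative (z s - ?I s) * exp (- s)) (at s within {0..t})"
      by (auto intro!: derivative_eq_intros simp: algebra_simps)
    show "(z s - ?I s) * exp (- s) \<le> 0"
      using bound[of s] s t by (simp add: mult_nonpos_nonneg)
  qed (use t in simp)
  then have "?I t * exp (- t) * exp t \<le> A * exp t"
    by (intro mult_right_mono) simp_all
  then have "?I t \<le> A * exp t"
    by (simp add: mult.assoc flip: exp_add)
  with bound[OF t] show ?thesis by simp
qed

lemma Gronwall_primitive: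
  assumes y: "integrable lborel y" and supp: "\<And>s. s < 0 \<Longrightarrow> y s = 0"
    and bound: "\<And>t. t \<in> {0..T} \<Longrightarrow> y t \<le> A + primitive y t"
    and t: "t \<in> {0..T}"
  shows "primitive y t \<le> A * (exp t - 1)"
proof -
  let ?z = "\<lambda>t. A + primitive y t"
  have cont: "continuous_on S ?z" for S
    by (intro continuous_intros continuous_at_imp_continuous_on ballI isCont_primitive[OF y])
  have "?z t \<le> A * exp t"
  proof (rule Gronwall_continuous[OF cont _ t])
    fix t assume t: "t \<in> {0..T}"
    have z: "set_integrable lborel {0..t} ?z"
      by (rule borel_integrable_atLeastAtMost') (rule cont)
    have "primitive y t = (LBINT s:{0..t}. y s)"
      by (rule primitive_eq_LBINT_Icc[OF supp])
    also have "\<dots> \<le> (LBINT s:{0..t}. ?z s)"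
      by (rule set_integral_mono[OF set_integrable_lborel[OF y] z]) (use bound t in auto)
    also have "\<dots> = integral {0..t} ?z"
      by (rule set_borel_integral_eq_integral(2)[OF z])
    finally show "?z t \<le> A + integral {0..t} ?z" by simp
  qed
  then show ?thesis by (simp add: algebra_simps)
qed

subsection \<open>Difference quotients of primitives\<close>

definition diff_quot :: "(real \<Rightarrow> real) \<Rightarrow> real \<Rightarrow> real \<Rightarrow> real" where
  "diff_quot f \<delta> t = (primitive f (t + \<delta>) - primitive f t) / \<delta>"

lemma diff_quot_measurable [measurable]:
  assumes [measurable]: "f \<in> borel_measurable borel"
  shows "diff_quot f \<delta> \<in> borel_measurable borel"
  unfolding diff_quot_def[abs_def] by measurable

lemma diff_quot_eq_LBINT:
  assumes f: "integrable lborel f" and \<delta>: "\<delta> \<noteq> 0"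
  shows "diff_quot f \<delta> t = (LBINT \<theta>:{0..1}. f (t + \<delta> * \<theta>))"
proof -
  have [measurable]: "f \<in> borel_measurable borel" using f by auto
  let ?h = "\<lambda>s. indicator {..t + \<delta>} s * f s - indicator {..t} s * f s"
  have "primitive f (t + \<delta>) - primitive f t = (\<integral>s. ?h s \<partial>lborel)"
    using set_integrable_lborel[OF f, of "{..t + \<delta>}"] set_integrable_lborel[OF f, of "{..t}"]
    by (simp add: primitive_def set_lebesgue_integral_def set_integrable_def)
  also have "\<dots> = \<bar>\<delta>\<bar> * (\<integral>\<theta>. ?h (t + \<delta> * \<theta>) \<partial>lborel)"
    by (subst lborel_integral_real_affine[OF \<delta>, of _ t]) simp
  also have "(\<integral>\<theta>. ?h (t + \<delta> * \<theta>) \<partial>lborel) = (\<integral>\<theta>. sgn \<delta> * (indicator {0..1} \<theta> *\<^sub>R f (t + \<delta> * \<theta>)) \<partial>lborel)"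
  proof (rule integral_cong_AE)
    show "AE \<theta> in lborel. ?h (t + \<delta> * \<theta>) = sgn \<delta> * (indicator {0..1} \<theta> *\<^sub>R f (t + \<delta> * \<theta>))"
      using AE_lborel_singleton[of 0] AE_lborel_singleton[of 1]
    proof eventually_elim
      case (elim \<theta>)
      have "\<delta> * \<theta> \<le> \<delta> \<longleftrightarrow> (if \<delta> > 0 then \<theta> \<le> 1 else 1 \<le> \<theta>)" "\<delta> * \<theta> \<le> 0 \<longleftrightarrow> (if \<delta> > 0 then \<theta> \<le> 0 else 0 \<le> \<theta>)"
        using \<delta> by (auto simp: mult_le_cancel_left1 mult_le_cancel_left2 mult_le_0_iff)
      then show ?case
        using elim \<delta> by (auto simp: indicator_def sgn_if)
    qed
  qed measurable
  finally show ?thesis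
    using \<delta> by (simp add: diff_quot_def set_lebesgue_integral_def sgn_if split: if_splits)
qed

lemma
  assumes f: "integrable lborel f" "square_integrable lborel f" and \<delta>: "\<delta> \<noteq> 0"
  shows square_integrable_diff_quot: "square_integrable lborel (diff_quot f \<delta>)"
    and integral_square_diff_quot_le: "(\<integral>t. (diff_quot f \<delta> t)\<^sup>2 \<partial>lborel) \<le> (\<integral>t. (f t)\<^sup>2 \<partial>lborel)"
proof -
  have [measurable]: "f \<in> borel_measurable borel" using f by auto
  let ?h = "\<lambda>\<theta> t. indicator {0..1} \<theta> * (f (t + \<delta> * \<theta>))\<^sup>2"
  note shift = integral_lborel_shift[of "\<lambda>t. (f t)\<^sup>2"]
  note shift_int = integrable_lborel_shift[OF square_integrableD[OF f(2)]]
  have pair_int: "integrable (lborel \<Otimes>\<^sub>M lborel) (\<lambda>(\<theta>, t). ?h \<theta> t)"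
  proof (rule lborel_pair.Fubini_integrable)
    show "(\<lambda>(\<theta>, t). ?h \<theta> t) \<in> borel_measurable (lborel \<Otimes>\<^sub>M lborel)" by measurable
    show "integrable lborel (\<lambda>\<theta>. \<integral>t. norm (case (\<theta>, t) of (\<theta>, t) \<Rightarrow> ?h \<theta> t) \<partial>lborel)"
      by (simp add: shift abs_mult integrable_indicator_iff emeasure_lborel_Icc_eq)
    show "AE \<theta> in lborel. integrable lborel (\<lambda>t. case (\<theta>, t) of (\<theta>, t) \<Rightarrow> ?h \<theta> t)"
      by (simp add: shift_int)
  qed
  have pointwise: "(diff_quot f \<delta> t)\<^sup>2 \<le> (\<integral>\<theta>. ?h \<theta> t \<partial>lborel)" for t
  proof -
    have "square_integrable lborel (\<lambda>\<theta>. f (t + \<delta> * \<theta>))"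
      using lborel_integrable_real_affine[OF square_integrableD[OF f(2)] \<delta>, of t]
      by (simp add: square_integrable_def)
    then have "square_integrable lborel (\<lambda>\<theta>. indicator {0..1} \<theta> * f (t + \<delta> * \<theta>))"
      by (rule square_integrable_bounded_mult[of _ _ 1, rotated 2]) auto
    from square_integral_Icc_supported_le[OF this, of 0 1] show ?thesis
      by (simp add: diff_quot_eq_LBINT[OF f(1) \<delta>] set_lebesgue_integral_def power_mult_distrib
          power2_eq_square[of "indicator _ _"] flip: indicator_inter_arith)
  qed
  have int: "integrable lborel (\<lambda>t. \<integral>\<theta>. ?h \<theta> t \<partial>lborel)"
    by (rule lborel_pair.integrable_snd[OF pair_int])
  have "integrable lborel (\<lambda>t. (diff_quot f \<delta> t)\<^sup>2)"
    by (rule integrable_if_abs_le[OF int]) (use pointwise in auto)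
  then show sq: "square_integrable lborel (diff_quot f \<delta>)"
    by (simp add: square_integrable_def)
  have "(\<integral>t. (diff_quot f \<delta> t)\<^sup>2 \<partial>lborel) \<le> (\<integral>t. (\<integral>\<theta>. ?h \<theta> t \<partial>lborel) \<partial>lborel)"
    by (rule integral_mono[OF square_integrableD[OF sq] int pointwise])
  also have "\<dots> = (\<integral>\<theta>. (\<integral>t. ?h \<theta> t \<partial>lborel) \<partial>lborel)"
    by (rule lborel_pair.Fubini_integral[OF pair_int])
  finally show "(\<integral>t. (diff_quot f \<delta> t)\<^sup>2 \<partial>lborel) \<le> (\<integral>t. (f t)\<^sup>2 \<partial>lborel)"
    by (simp add: shift)
qed

lemma diff_quot_tendsto_L2:
  assumes f: "integrable lborel f" "square_integrable lborel f"
    and X: "X \<longlonglongrightarrow> 0" "\<And>n. X n \<noteq> 0"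
  shows "(\<lambda>n. \<integral>t. (diff_quot f (X n) t - f t)\<^sup>2 \<partial>lborel) \<longlonglongrightarrow> 0"
proof (rule Scheffe_square[OF f(2)])
  show "AE t in lborel. (\<lambda>n. diff_quot f (X n) t) \<longlonglongrightarrow> f t"
    using AE_has_real_derivative_primitive[OF f(1)]
  proof eventually_elim
    case (elim t)
    then have "((\<lambda>\<delta>. diff_quot f \<delta> t) \<longlongrightarrow> f t) (at 0)"
      by (simp add: DERIV_def diff_quot_def)
    with X show ?case
      unfolding tendsto_at_iff_sequentially comp_def by simp
  qed
qed (use f X in \<open>auto intro: square_integrable_diff_quot integral_square_diff_quot_le\<close>)

lemma tendsto_primitive_mult_L2:
  assumes f: "square_integrable lborel f" "\<And>n. square_integrable lborel (F n)"
    and g: "square_integrable lborel g"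
    and lim: "(\<lambda>n. \<integral>t. (F n t - f t)\<^sup>2 \<partial>lborel) \<longlonglongrightarrow> 0" and X: "X \<longlonglongrightarrow> a"
  shows "(\<lambda>n. primitive (\<lambda>t. F n t * g t) (X n)) \<longlonglongrightarrow> primitive (\<lambda>t. f t * g t) a"
proof -
  have fg: "integrable lborel (\<lambda>t. f t * g t)" and Fg: "integrable lborel (\<lambda>t. (F n t - f t) * g t)" for n
    by (intro integrable_mult_square_integrable square_integrable_diff f g)+
  have "(\<lambda>n. primitive (\<lambda>t. (F n t - f t) * g t) (X n)) \<longlonglongrightarrow> 0"
    by (rule Lim_null_comparison[OF _ tendsto_integral_abs_mult_L2[OF f g lim]])
       (simp add: abs_primitive_le[OF Fg])
  moreover have "(\<lambda>n. primitive (\<lambda>t. f t * g t) (X n)) \<longlonglongrightarrow> primitive (\<lambda>t. f t * g t) a"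
    by (rule isCont_tendsto_compose[OF isCont_primitive[OF fg] X])
  moreover have "primitive (\<lambda>t. (F n t - f t) * g t) s + primitive (\<lambda>t. f t * g t) s
      = primitive (\<lambda>t. F n t * g t) s" for n s
    unfolding primitive_add[OF Fg fg, symmetric] by (simp add: left_diff_distrib)
  ultimately show ?thesis
    using tendsto_add by fastforce
qed

text \<open>Writing the product with \<open>g (t + \<delta>)\<close> as a backward quotient at the shifted time avoids translating \<open>g\<close>.\<close>

lemma primitive_increment_pairing_eq:
  assumes f: "integrable lborel f" "square_integrable lborel f" and g: "square_integrable lborel g"
    and \<delta>: "\<delta> \<noteq> 0"
  shows "primitive (\<lambda>t. (primitive f (t + \<delta>) - primitive f t) * (g (t + \<delta>) + g t)) \<tau> / \<delta>
    = primitive (\<lambda>t. diff_quot f (- \<delta>) t * g t) (\<tau> + \<delta>) + primitive (\<lambda>t. diff_quot f \<delta> t * g t) \<tau>"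
proof -
  have quot_int: "integrable lborel (\<lambda>t. diff_quot f \<epsilon> t * g t)" if "\<epsilon> \<noteq> 0" for \<epsilon>
    by (intro integrable_mult_square_integrable square_integrable_diff_quot f g that)
  have shifted_int: "integrable lborel (\<lambda>t. diff_quot f (- \<delta>) (t + \<delta>) * g (t + \<delta>))"
    using integrable_lborel_shift[OF quot_int[of "- \<delta>"], of \<delta>] \<delta> by simp
  have "primitive f (t + \<delta>) - primitive f t = \<delta> * diff_quot f \<delta> t"
    "diff_quot f (- \<delta>) (t + \<delta>) = diff_quot f \<delta> t" for t
    using \<delta> by (simp_all add: diff_quot_def field_simps)
  then have "primitive (\<lambda>t. (primitive f (t + \<delta>) - primitive f t) * (g (t + \<delta>) + g t)) \<tau>
      = primitive (\<lambda>t. \<delta> * (diff_quot f (- \<delta>) (t + \<delta>) * g (t + \<delta>) + diff_quot f \<delta> t * g t)) \<tau>"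
    by (simp add: distrib_left mult.assoc)
  also have "\<dots> = \<delta> * (primitive (\<lambda>t. diff_quot f (- \<delta>) (t + \<delta>) * g (t + \<delta>)) \<tau>
      + primitive (\<lambda>t. diff_quot f \<delta> t * g t) \<tau>)"
    using shifted_int quot_int[OF \<delta>] by (simp add: primitive_cmult primitive_add)
  finally show ?thesis
    using \<delta> primitive_shift[of "\<lambda>t. diff_quot f (- \<delta>) t * g t"] by simp
qed

lemma primitive_increment_pairing_tendsto:
  assumes f: "integrable lborel f" "square_integrable lborel f" and g: "square_integrable lborel g"
    and X: "X \<longlonglongrightarrow> 0" "\<And>n. X n \<noteq> 0"
  shows "(\<lambda>n. primitive (\<lambda>t. (primitive f (t + X n) - primitive f t) * (g (t + X n) + g t)) \<tau> / X n)
    \<longlonglongrightarrow> 2 * primitive (\<lambda>t. f t * g t) \<tau>"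
proof -
  have neg: "(\<lambda>n. - X n) \<longlonglongrightarrow> 0" "\<And>n. - X n \<noteq> 0"
    using tendsto_minus[OF X(1)] X(2) by auto
  have shift: "(\<lambda>n. \<tau> + X n) \<longlonglongrightarrow> \<tau>"
    using tendsto_add[OF tendsto_const X(1), of \<tau>] by simp
  have "(\<lambda>n. primitive (\<lambda>t. diff_quot f (- X n) t * g t) (\<tau> + X n)
        + primitive (\<lambda>t. diff_quot f (X n) t * g t) \<tau>)
      \<longlonglongrightarrow> primitive (\<lambda>t. f t * g t) \<tau> + primitive (\<lambda>t. f t * g t) \<tau>"
    by (intro tendsto_add tendsto_primitive_mult_L2 diff_quot_tendsto_L2 square_integrable_diff_quot
        f g X neg shift tendsto_const)
  then show ?thesis
    by (simp add: primitive_increment_pairing_eq[OF f g X(2)])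
qed

lemma abs_primitive_mult_le:
  assumes "square_integrable lborel f" "square_integrable lborel g"
  shows "2 * \<bar>primitive (\<lambda>t. f t * g t) \<tau>\<bar> \<le> (\<integral>t. (f t)\<^sup>2 \<partial>lborel) + (\<integral>t. (g t)\<^sup>2 \<partial>lborel)"
proof -
  note int = integrable_mult_square_integrable[OF assms]
  have "2 * \<bar>primitive (\<lambda>t. f t * g t) \<tau>\<bar> \<le> (\<integral>t. 2 * \<bar>f t * g t\<bar> \<partial>lborel)"
    using abs_primitive_le[OF int, of \<tau>] by simp
  also have "\<dots> \<le> (\<integral>t. (f t)\<^sup>2 + (g t)\<^sup>2 \<partial>lborel)"
    using int assms by (intro integral_mono two_mult_abs_le_sum_squares) (auto simp: square_integrableD)
  finally show ?thesis
    using assms by (simp add: square_integrableD)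
qed

lemma abs_primitive_increment_pairing_le:
  assumes f: "integrable lborel f" "square_integrable lborel f" and g: "square_integrable lborel g"
    and \<delta>: "\<delta> \<noteq> 0"
  shows "\<bar>primitive (\<lambda>t. (primitive f (t + \<delta>) - primitive f t) * (g (t + \<delta>) + g t)) \<tau> / \<delta>\<bar>
    \<le> (\<integral>t. (f t)\<^sup>2 \<partial>lborel) + (\<integral>t. (g t)\<^sup>2 \<partial>lborel)"
proof -
  have "2 * \<bar>primitive (\<lambda>t. diff_quot f \<epsilon> t * g t) \<sigma>\<bar> \<le> (\<integral>t. (f t)\<^sup>2 \<partial>lborel) + (\<integral>t. (g t)\<^sup>2 \<partial>lborel)"
    if "\<epsilon> \<noteq> 0" for \<epsilon> \<sigma>
    using abs_primitive_mult_le[OF square_integrable_diff_quot[OF f that] g, of \<sigma>]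
      integral_square_diff_quot_le[OF f that] by linarith
  from this[of "- \<delta>" "\<tau> + \<delta>"] this[of \<delta> \<tau>] \<delta> show ?thesis
    unfolding primitive_increment_pairing_eq[OF f g \<delta>] by linarith
qed

section \<open>Square integrable fields on a space-time rectangle\<close>

text \<open>Square integrability of every single section is part of the definition,
  so that slices need no almost-everywhere quantifiers.\<close>

definition L2_field :: "real \<Rightarrow> real \<Rightarrow> (real \<Rightarrow> real \<Rightarrow> real) \<Rightarrow> bool" where
  "L2_field l T f \<longleftrightarrow> square_integrable (lborel \<Otimes>\<^sub>M lborel) (case_prod f) \<and>
     (\<forall>x. square_integrable lborel (f x)) \<and> (\<forall>t. square_integrable lborel (\<lambda>x. f x t)) \<and>
     (\<forall>x t. x \<notin> {0..l} \<or> t \<notin> {0..T} \<longrightarrow> f x t = 0)"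

lemma L2_field_measurable [measurable_dest]:
  assumes "L2_field l T f"
  shows "case_prod f \<in> borel_measurable (borel \<Otimes>\<^sub>M borel)"
proof -
  have "case_prod f \<in> borel_measurable (lborel \<Otimes>\<^sub>M lborel)"
    using assms by (simp add: L2_field_def square_integrable_def)
  then show ?thesis by measurable
qed

lemma
  assumes "L2_field l T f"
  shows L2_field_pair: "square_integrable (lborel \<Otimes>\<^sub>M lborel) (case_prod f)"
    and L2_field_time: "square_integrable lborel (f x)"
    and L2_field_space: "square_integrable lborel (\<lambda>x. f x t)"
    and L2_field_eq_0: "x \<notin> {0..l} \<or> t \<notin> {0..T} \<Longrightarrow> f x t = 0"
  using assms by (auto simp: L2_field_def)

lemma L2_field_section_eq_0: "L2_field l T f \<Longrightarrow> x \<notin> {0..l} \<Longrightarrow> f x = (\<lambda>_. 0)"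
  using L2_field_eq_0 by blast

lemma L2_field_swap:
  assumes f: "L2_field l T f"
  shows "L2_field T l (\<lambda>t x. f x t)"
proof -
  have "integrable (lborel \<Otimes>\<^sub>M lborel) (\<lambda>z. (case z of (t, x) \<Rightarrow> f x t)\<^sup>2)"
    using lborel_pair.integrable_product_swap[OF square_integrableD[OF L2_field_pair[OF f]]]
    by (simp add: case_prod_unfold)
  moreover have "(\<lambda>(t, x). f x t) \<in> borel_measurable (lborel \<Otimes>\<^sub>M lborel)"
    using f by measurable
  ultimately have "square_integrable (lborel \<Otimes>\<^sub>M lborel) (\<lambda>(t, x). f x t)"
    unfolding square_integrable_def by blast
  with f show ?thesis by (auto simp: L2_field_def)
qed

lemma L2_field_integrable_time:
  assumes "L2_field l T f"
  shows "integrable lborel (f x)"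
  by (rule integrable_if_square_integrable_Icc[OF L2_field_time[OF assms], of 0 T])
     (use L2_field_eq_0[OF assms] in auto)

lemma L2_field_integrable_space: "L2_field l T f \<Longrightarrow> integrable lborel (\<lambda>x. f x t)"
  using L2_field_integrable_time[OF L2_field_swap] .

lemma L2_field_integrable:
  assumes "L2_field l T f"
  shows "integrable (lborel \<Otimes>\<^sub>M lborel) (\<lambda>(x, t). f x t)"
proof (rule integrable_if_square_integrable[OF L2_field_pair[OF assms], of "{0..l} \<times> {0..T}"])
  show "emeasure (lborel \<Otimes>\<^sub>M lborel) ({0..l} \<times> {0..T}) < \<infinity>"
    by (subst lborel.emeasure_pair_measure_Times) (auto simp: emeasure_lborel_Icc_eq ennreal_mult_less_top)
  show "(case z of (x, t) \<Rightarrow> f x t) = 0" if "z \<notin> {0..l} \<times> {0..T}" for z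
    using that L2_field_eq_0[OF assms, of "fst z" "snd z"] by (auto simp: case_prod_unfold mem_Times_iff)
qed simp

lemma L2_field_integrable_mult:
  assumes "L2_field l T f" "L2_field l T g"
  shows "integrable (lborel \<Otimes>\<^sub>M lborel) (\<lambda>(x, t). f x t * g x t)"
  using integrable_mult_square_integrable[OF assms[THEN L2_field_pair]] by (simp add: case_prod_unfold)

lemma L2_field_integrable_norm_time:
  assumes "L2_field l T f"
  shows "integrable lborel (\<lambda>x. \<integral>t. (f x t)\<^sup>2 \<partial>lborel)"
  using lborel_pair.integrable_fst[OF L2_field_integrable_mult[OF assms assms]] by (simp add: power2_eq_square)

lemma L2_field_integrable_norm_space:
  "L2_field l T f \<Longrightarrow> integrable lborel (\<lambda>t. \<integral>x. (f x t)\<^sup>2 \<partial>lborel)"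
  using L2_field_integrable_norm_time[OF L2_field_swap] .

lemma L2_field_add:
  assumes "L2_field l T f" "L2_field l T g"
  shows "L2_field l T (\<lambda>x t. f x t + g x t)"
  using assms square_integrable_add[OF assms[THEN L2_field_pair]]
  by (auto simp: L2_field_def case_prod_unfold intro: square_integrable_add)

lemma L2_field_diff:
  assumes "L2_field l T f" "L2_field l T g"
  shows "L2_field l T (\<lambda>x t. f x t - g x t)"
  using assms square_integrable_diff[OF assms[THEN L2_field_pair]]
  by (auto simp: L2_field_def case_prod_unfold intro: square_integrable_diff)

lemma L2_field_coeff_mult:
  assumes f: "L2_field l T f" and [measurable]: "\<beta> \<in> borel_measurable borel" and \<beta>: "\<And>x. \<bar>\<beta> x\<bar> \<le> C"
  shows "L2_field l T (\<lambda>x t. \<beta> x * f x t)"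
proof -
  have "square_integrable (lborel \<Otimes>\<^sub>M lborel) (\<lambda>z. \<beta> (fst z) * case_prod f z)"
    by (rule square_integrable_bounded_mult[OF _ _ L2_field_pair[OF f], of _ C]) (use \<beta> in auto)
  moreover have "square_integrable lborel (\<lambda>x. \<beta> x * f x t)" for t
    by (rule square_integrable_bounded_mult[OF _ _ L2_field_space[OF f], of _ C]) (use \<beta> in auto)
  ultimately show ?thesis
    using f by (auto simp: L2_field_def case_prod_unfold intro: square_integrable_cmult)
qed

lemma L2_field_tensor:
  assumes a: "square_integrable lborel a" "\<And>x. x \<notin> {0..l} \<Longrightarrow> a x = 0"
    and b: "square_integrable lborel b" "\<And>t. t \<notin> {0..T} \<Longrightarrow> b t = 0"
  shows "L2_field l T (\<lambda>x t. a x * b t)"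
proof -
  have [measurable]: "a \<in> borel_measurable borel" "b \<in> borel_measurable borel"
    using a(1) b(1) by (simp_all add: square_integrable_def)
  have "square_integrable (lborel \<Otimes>\<^sub>M lborel) (\<lambda>(x, t). a x * b t)"
    using integrable_pair_mult[OF a(1)[THEN square_integrableD] b(1)[THEN square_integrableD]]
    by (simp add: square_integrable_def case_prod_unfold power_mult_distrib)
  moreover have "square_integrable lborel (\<lambda>x. a x * b t)" for t
    using square_integrable_cmult[OF a(1), of "b t"] by (simp add: mult.commute)
  ultimately show ?thesis
    using a b by (auto simp: L2_field_def intro: square_integrable_cmult)
qed

lemma L2_field_if_square_le_norm_space:
  assumes g: "L2_field l T g" and [measurable]: "case_prod f \<in> borel_measurable (borel \<Otimes>\<^sub>M borel)"
    and supp: "\<And>x t. x \<notin> {0..l} \<or> t \<notin> {0..T} \<Longrightarrow> f x t = 0"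
    and square_le: "\<And>x t. (f x t)\<^sup>2 \<le> C * (\<integral>y. (g y t)\<^sup>2 \<partial>lborel)"
  shows "L2_field l T f"
proof -
  let ?N = "\<lambda>t. C * (\<integral>y. (g y t)\<^sup>2 \<partial>lborel)"
  have norm_int: "integrable lborel ?N"
    using L2_field_integrable_norm_space[OF g] by simp
  have ind_int: "integrable lborel (indicator {0..l} :: real \<Rightarrow> real)"
    by (simp add: integrable_indicator_iff emeasure_lborel_Icc_eq)
  have bound: "(f x t)\<^sup>2 \<le> indicator {0..l} x * ?N t" for x t
    using square_le[of x t] supp[of x t] by (cases "x \<in> {0..l}") auto
  have "integrable (lborel \<Otimes>\<^sub>M lborel) (\<lambda>z. (case_prod f z)\<^sup>2)"
    by (rule integrable_if_abs_le[OF integrable_pair_mult[OF ind_int norm_int]]) (use bound in auto)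
  moreover have "integrable lborel (\<lambda>x. (f x t)\<^sup>2)" for t
    by (rule integrable_if_abs_le[of _ "\<lambda>x. indicator {0..l} x * ?N t"]) (use ind_int bound in auto)
  moreover have "integrable lborel (\<lambda>t. (f x t)\<^sup>2)" for x
    by (rule integrable_if_abs_le[OF norm_int]) (use square_le in auto)
  ultimately show ?thesis
    using supp by (auto simp: L2_field_def square_integrable_def)
qed

lemma L2_field_kernel:
  assumes f: "L2_field l T f" and k [measurable]: "case_prod k \<in> borel_measurable (borel \<Otimes>\<^sub>M borel)"
    and bound: "\<And>x s. \<bar>k x s\<bar> \<le> C" and supp: "\<And>x s. x \<notin> {0..l} \<or> s \<notin> {0..l} \<Longrightarrow> k x s = 0"
    and "0 \<le> l"
  shows "L2_field l T (\<lambda>x t. \<integral>s. k x s * f s t \<partial>lborel)"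
proof (rule L2_field_if_square_le_norm_space[OF f])
  have [measurable]: "case_prod f \<in> borel_measurable (borel \<Otimes>\<^sub>M borel)"
    by (rule L2_field_measurable[OF f])
  show "(\<lambda>(x, t). \<integral>s. k x s * f s t \<partial>lborel) \<in> borel_measurable (borel \<Otimes>\<^sub>M borel)"
    by measurable
  show "(\<integral>s. k x s * f s t \<partial>lborel) = 0" if "x \<notin> {0..l} \<or> t \<notin> {0..T}" for x t
    using that supp L2_field_eq_0[OF f] by auto
  show "(\<integral>s. k x s * f s t \<partial>lborel)\<^sup>2 \<le> l * C\<^sup>2 * (\<integral>s. (f s t)\<^sup>2 \<partial>lborel)" for x t
  proof -
    note ft = L2_field_space[OF f, of t]
    have kf: "square_integrable lborel (\<lambda>s. k x s * f s t)"
      by (rule square_integrable_bounded_mult[OF _ _ ft, of _ C]) (use bound in auto)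
    have "(\<integral>s. k x s * f s t \<partial>lborel)\<^sup>2 \<le> l * (\<integral>s. (k x s * f s t)\<^sup>2 \<partial>lborel)"
      using square_integral_Icc_supported_le[OF kf, of 0 l] supp \<open>0 \<le> l\<close> by simp
    also have "\<dots> \<le> l * (\<integral>s. C\<^sup>2 * (f s t)\<^sup>2 \<partial>lborel)"
    proof (intro mult_left_mono[OF integral_mono] \<open>0 \<le> l\<close>)
      show "(k x s * f s t)\<^sup>2 \<le> C\<^sup>2 * (f s t)\<^sup>2" for s
        using power_mono[OF bound[of x s], of 2] by (simp add: power_mult_distrib mult_right_mono)
    qed (use kf ft in \<open>auto simp: square_integrableD\<close>)
    finally show ?thesis by simp
  qed
qed

definition time_primitive :: "real \<Rightarrow> (real \<Rightarrow> real \<Rightarrow> real) \<Rightarrow> real \<Rightarrow> real \<Rightarrow> real" where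
  "time_primitive T f x t = indicator {0..T} t * primitive (f x) t"

lemma time_primitive_eq:
  assumes "L2_field l T f" "t \<le> T"
  shows "time_primitive T f x t = primitive (f x) t"
proof (cases "0 \<le> t")
  case False
  then have "primitive (f x) t = primitive (\<lambda>_. 0) t"
    by (intro primitive_cong L2_field_eq_0[OF assms(1)]) auto
  then show ?thesis using False by (simp add: time_primitive_def primitive_def)
qed (use assms(2) in \<open>simp add: time_primitive_def\<close>)

lemma L2_field_time_primitive:
  assumes f: "L2_field l T f" and "0 \<le> T"
  shows "L2_field l T (time_primitive T f)"
proof -
  have "L2_field T l (\<lambda>t x. time_primitive T f x t)"
  proof (rule L2_field_if_square_le_norm_space[OF L2_field_swap[OF f]])
    have [measurable]: "case_prod f \<in> borel_measurable (borel \<Otimes>\<^sub>M borel)"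
      by (rule L2_field_measurable[OF f])
    show "(\<lambda>(t, x). time_primitive T f x t) \<in> borel_measurable (borel \<Otimes>\<^sub>M borel)"
      unfolding time_primitive_def by measurable
    show "time_primitive T f x t = 0" if "t \<notin> {0..T} \<or> x \<notin> {0..l}" for t x
      using that L2_field_section_eq_0[OF f, of x] by (auto simp: time_primitive_def primitive_def)
    have "(primitive (f x) t)\<^sup>2 \<le> (T - 0) * (\<integral>s. (f x s)\<^sup>2 \<partial>lborel)" for t x
      by (rule square_primitive_le[OF L2_field_time[OF f]]) (use \<open>0 \<le> T\<close> L2_field_eq_0[OF f] in auto)
    then show "(time_primitive T f x t)\<^sup>2 \<le> T * (\<integral>s. (f x s)\<^sup>2 \<partial>lborel)" for t x
      using \<open>0 \<le> T\<close> by (simp add: time_primitive_def indicator_def)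
  qed
  from L2_field_swap[OF this] show ?thesis .
qed

lemma L2_field_integrable_increment_mult:
  assumes f: "L2_field l T f" and g: "L2_field l T g"
  shows "integrable (lborel \<Otimes>\<^sub>M lborel) (\<lambda>(x, t). (f x (t + \<delta>) - f x t) * (g x (t + \<delta>) + g x t))"
proof -
  have shift: "square_integrable (lborel \<Otimes>\<^sub>M lborel) (\<lambda>(x, t). h x (t + \<delta>))"
    if h: "L2_field l T h" for h
  proof -
    have [measurable]: "case_prod h \<in> borel_measurable (borel \<Otimes>\<^sub>M borel)"
      by (rule L2_field_measurable[OF h])
    have "integrable (lborel \<Otimes>\<^sub>M lborel) (\<lambda>(x, t). (h x (t + \<delta>))\<^sup>2)"
      using L2_field_integrable_norm_time[OF h]
        integrable_lborel_shift[OF square_integrableD[OF L2_field_time[OF h]]]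
        integral_lborel_shift[of "\<lambda>t. (h x t)\<^sup>2" for x]
      by (intro lborel_pair.Fubini_integrable) auto
    then show ?thesis
      by (simp add: square_integrable_def case_prod_unfold)
  qed
  have "integrable (lborel \<Otimes>\<^sub>M lborel) (\<lambda>z. ((case z of (x, t) \<Rightarrow> f x (t + \<delta>)) - case_prod f z)
      * ((case z of (x, t) \<Rightarrow> g x (t + \<delta>)) + case_prod g z))"
    by (intro integrable_mult_square_integrable square_integrable_diff square_integrable_add
        shift[OF f] shift[OF g] L2_field_pair[OF f] L2_field_pair[OF g])
  then show ?thesis by (simp add: case_prod_unfold)
qed

lemma
  assumes g: "integrable (lborel \<Otimes>\<^sub>M lborel) (\<lambda>(x, t). g x t)"
  shows integral_primitive: "(\<integral>x. primitive (g x) \<tau> \<partial>lborel) = primitive (\<lambda>t. \<integral>x. g x t \<partial>lborel) \<tau>"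
    and integrable_primitive: "integrable lborel (\<lambda>x. primitive (g x) \<tau>)"
proof -
  have int: "integrable (lborel \<Otimes>\<^sub>M lborel) (\<lambda>(x, t). indicator {..\<tau>} t *\<^sub>R g x t)"
    by (rule Bochner_Integration.integrable_bound[OF g])
       (use borel_measurable_integrable[OF g] in \<open>auto simp: indicator_def\<close>)
  show "integrable lborel (\<lambda>x. primitive (g x) \<tau>)"
    using lborel_pair.integrable_fst[OF int] by (simp add: primitive_def set_lebesgue_integral_def)
  show "(\<integral>x. primitive (g x) \<tau> \<partial>lborel) = primitive (\<lambda>t. \<integral>x. g x t \<partial>lborel) \<tau>"
    using lborel_pair.Fubini_integral[OF int] by (simp add: primitive_def set_lebesgue_integral_def)
qed

section \<open>The clamped beam\<close>

definition clamped_kernel :: "real \<Rightarrow> real \<Rightarrow> real \<Rightarrow> real" where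
  "clamped_kernel l x s = indicator {0..l} x * indicator {0..l} s * max 0 (x - s)"

text \<open>\<open>deflection l \<phi>\<close> is the function \<open>v\<close> with \<open>v(0) = v'(0) = 0\<close> and \<open>v'' = \<phi>\<close>.\<close>

definition deflection :: "real \<Rightarrow> (real \<Rightarrow> real) \<Rightarrow> real \<Rightarrow> real" where
  "deflection l \<phi> x = (\<integral>s. clamped_kernel l x s * \<phi> s \<partial>lborel)"

lemma clamped_kernel_measurable [measurable]:
  "case_prod (clamped_kernel l) \<in> borel_measurable (borel \<Otimes>\<^sub>M borel)"
  unfolding clamped_kernel_def[abs_def] by measurable

lemma clamped_kernel_eq_0: "x \<notin> {0..l} \<or> s \<notin> {0..l} \<Longrightarrow> clamped_kernel l x s = 0"
  by (auto simp: clamped_kernel_def)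

lemma abs_clamped_kernel_le: "0 \<le> l \<Longrightarrow> \<bar>clamped_kernel l x s\<bar> \<le> l"
  by (auto simp: clamped_kernel_def indicator_def)

text \<open>Here \<open>d\<close> and \<open>curv_rate\<close> stand for \<open>g'\<close> and \<open>u\<^sub>x\<^sub>x\<^sub>t\<close>; the fields \<open>velocity\<close> and \<open>curv\<close> below
  recover \<open>u\<^sub>t\<close> and \<open>u\<^sub>x\<^sub>x\<close> from the latter.\<close>

locale beam =
  fixes l T c \<rho>0 r0 \<kappa>0 M :: real and \<rho> \<mu> r \<kappa> d :: "real \<Rightarrow> real"
    and curv_rate :: "real \<Rightarrow> real \<Rightarrow> real"
  assumes l_pos: "0 < l" and T_pos: "0 < T" and \<rho>0_pos: "0 < \<rho>0" and r0_pos: "0 < r0" and \<kappa>0_pos: "0 < \<kappa>0"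
    and coeff_measurable [measurable]: "\<rho> \<in> borel_measurable borel" "\<mu> \<in> borel_measurable borel"
      "r \<in> borel_measurable borel" "\<kappa> \<in> borel_measurable borel"
    and \<rho>_bounds: "\<And>x. \<rho>0 \<le> \<rho> x" "\<And>x. \<rho> x \<le> M"
    and \<mu>_bounds: "\<And>x. 0 \<le> \<mu> x" "\<And>x. \<mu> x \<le> M"
    and r_bounds: "\<And>x. r0 \<le> r x" "\<And>x. r x \<le> M"
    and \<kappa>_bounds: "\<And>x. \<kappa>0 \<le> \<kappa> x" "\<And>x. \<kappa> x \<le> M"
    and d_L2: "square_integrable lborel d" and d_support: "\<And>t. t \<notin> {0..T} \<Longrightarrow> d t = 0"
    and curv_rate_L2: "L2_field l T curv_rate"
begin

definition velocity :: "real \<Rightarrow> real \<Rightarrow> real" where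
  "velocity x t = deflection l (\<lambda>s. curv_rate s t) x"

text \<open>\<open>moment \<beta>\<close> integrates \<open>\<beta> u\<^sub>t\<close> twice from the free end, so that \<open>(moment \<beta>, \<phi>) = (\<beta> u\<^sub>t, deflection l \<phi>)\<close>.\<close>

definition moment :: "(real \<Rightarrow> real) \<Rightarrow> real \<Rightarrow> real \<Rightarrow> real" where
  "moment \<beta> x t = (\<integral>y. clamped_kernel l y x * (\<beta> y * velocity y t) \<partial>lborel)"

definition curv :: "real \<Rightarrow> real \<Rightarrow> real" where
  "curv = time_primitive T curv_rate"

definition load :: "real \<Rightarrow> real \<Rightarrow> real" where
  "load x t = indicator {0..l} x * (c + l - x) * (indicator {0..T} t * primitive d t)"

definition moment_rate :: "real \<Rightarrow> real \<Rightarrow> real" where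
  "moment_rate x t = load x t - moment \<mu> x t - r x * curv x t - \<kappa> x * curv_rate x t"

definition impulse :: "real \<Rightarrow> real \<Rightarrow> real" where
  "impulse = time_primitive T moment_rate"

lemma abs_coeff_le: "\<bar>\<rho> x\<bar> \<le> M" "\<bar>\<mu> x\<bar> \<le> M" "\<bar>r x\<bar> \<le> M" "\<bar>\<kappa> x\<bar> \<le> M"
  using \<rho>_bounds[of x] \<mu>_bounds[of x] r_bounds[of x] \<kappa>_bounds[of x] \<rho>0_pos r0_pos \<kappa>0_pos by auto

lemma d_integrable: "integrable lborel d"
  by (rule integrable_if_square_integrable_Icc[OF d_L2 d_support])

lemma velocity_L2: "L2_field l T velocity"
  unfolding velocity_def[abs_def] deflection_def
  using L2_field_kernel[OF curv_rate_L2 clamped_kernel_measurable abs_clamped_kernel_le clamped_kernel_eq_0]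
    l_pos by (simp add: case_prod_unfold)

lemma coeff_velocity_L2: "L2_field l T (\<lambda>x t. \<rho> x * velocity x t)"
  by (rule L2_field_coeff_mult[OF velocity_L2 _ abs_coeff_le(1)]) measurable

lemma moment_L2:
  assumes "\<beta> \<in> borel_measurable borel" "\<And>x. \<bar>\<beta> x\<bar> \<le> C"
  shows "L2_field l T (moment \<beta>)"
  unfolding moment_def[abs_def]
  by (rule L2_field_kernel[OF L2_field_coeff_mult[OF velocity_L2 assms], of _ l])
     (use l_pos abs_clamped_kernel_le clamped_kernel_eq_0 in \<open>auto simp: less_imp_le\<close>)

lemmas momentum_L2 = moment_L2[OF coeff_measurable(1) abs_coeff_le(1)]
  and damping_L2 = moment_L2[OF coeff_measurable(2) abs_coeff_le(2)]

lemma curv_L2: "L2_field l T curv"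
  unfolding curv_def using L2_field_time_primitive[OF curv_rate_L2] T_pos by simp

lemma load_L2: "L2_field l T load"
  unfolding load_def[abs_def]
proof (rule L2_field_tensor)
  show "square_integrable lborel (\<lambda>x. indicator {0..l} x * (c + l - x))"
  proof (rule square_integrable_if_abs_le)
    show "square_integrable lborel (\<lambda>x. (\<bar>c\<bar> + l) * indicator {0..l} x)"
      by (intro square_integrable_cmult square_integrable_indicator_Icc)
  qed (use l_pos in \<open>auto simp: indicator_def\<close>)
  have [measurable]: "d \<in> borel_measurable borel" using d_integrable by auto
  show "square_integrable lborel (\<lambda>t. indicator {0..T} t * primitive d t)"
  proof (rule square_integrable_if_abs_le)
    show "square_integrable lborel (\<lambda>t. (\<integral>s. \<bar>d s\<bar> \<partial>lborel) * indicator {0..T} t)"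
      by (intro square_integrable_cmult square_integrable_indicator_Icc)
    show "\<bar>indicator {0..T} t * primitive d t\<bar> \<le> \<bar>(\<integral>s. \<bar>d s\<bar> \<partial>lborel) * indicator {0..T} t\<bar>" for t
      using abs_primitive_le[OF d_integrable, of t] by (auto simp: indicator_def)
  qed measurable
qed auto

lemma moment_rate_L2: "L2_field l T moment_rate"
  unfolding moment_rate_def[abs_def]
  by (intro L2_field_diff L2_field_coeff_mult[of _ _ _ _ M] load_L2 damping_L2 curv_L2 curv_rate_L2
      abs_coeff_le) auto

lemma impulse_L2: "L2_field l T impulse"
  unfolding impulse_def using L2_field_time_primitive[OF moment_rate_L2] T_pos by simp

lemmas fields_measurable [measurable] =
  curv_rate_L2[THEN L2_field_measurable] velocity_L2[THEN L2_field_measurable]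
  curv_L2[THEN L2_field_measurable] load_L2[THEN L2_field_measurable]
  moment_rate_L2[THEN L2_field_measurable] impulse_L2[THEN L2_field_measurable]
  momentum_L2[THEN L2_field_measurable] damping_L2[THEN L2_field_measurable]


lemma integral_moment_mult:
  assumes "\<beta> \<in> borel_measurable borel" "\<And>x. \<bar>\<beta> x\<bar> \<le> C" and \<phi>: "integrable lborel \<phi>"
  shows "(\<integral>x. moment \<beta> x t * \<phi> x \<partial>lborel) = (\<integral>x. \<beta> x * velocity x t * deflection l \<phi> x \<partial>lborel)"
  unfolding moment_def deflection_def
  using l_pos
  by (intro integral_kernel_adjoint[symmetric, OF _ \<phi> clamped_kernel_measurable abs_clamped_kernel_le]
      L2_field_integrable_space[OF L2_field_coeff_mult[OF velocity_L2 assms(1,2)]]) simp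

subsection \<open>The energy identity\<close>

definition kinetic :: "real \<Rightarrow> real" where
  "kinetic t = (\<integral>x. \<rho> x * (velocity x t)\<^sup>2 \<partial>lborel)"

definition action :: "real \<Rightarrow> real" where
  "action = primitive kinetic"

definition work :: "real \<Rightarrow> real" where
  "work \<tau> = 2 * (\<integral>x. primitive (\<lambda>t. moment_rate x t * curv_rate x t) \<tau> \<partial>lborel)"

lemma kinetic_nonneg: "0 \<le> kinetic t"
  unfolding kinetic_def
  by (intro integral_nonneg_AE AE_I2 mult_nonneg_nonneg order.trans[OF less_imp_le[OF \<rho>0_pos] \<rho>_bounds(1)]) simp

lemma kinetic_integrable: "integrable lborel kinetic"
  using lborel_pair.integrable_snd[OF L2_field_integrable_mult[OF coeff_velocity_L2 velocity_L2]]
  by (simp add: kinetic_def[abs_def] power2_eq_square mult.assoc)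

lemma kinetic_eq_0: "t \<notin> {0..T} \<Longrightarrow> kinetic t = 0"
  by (simp add: kinetic_def L2_field_eq_0[OF velocity_L2])

lemma action_mono: "\<sigma> \<le> \<tau> \<Longrightarrow> action \<sigma> \<le> action \<tau>"
  unfolding action_def primitive_def set_lebesgue_integral_def
  using set_integrable_lborel[OF kinetic_integrable, of "{..\<sigma>}"]
    set_integrable_lborel[OF kinetic_integrable, of "{..\<tau>}"]
  by (intro integral_mono) (auto simp: set_integrable_def indicator_def kinetic_nonneg)

lemma kinetic_diff:
  "kinetic t - kinetic t' = (\<integral>x. (moment \<rho> x t - moment \<rho> x t') * (curv_rate x t + curv_rate x t') \<partial>lborel)"
proof -
  have pairing: "(\<integral>x. moment \<rho> x a * curv_rate x b \<partial>lborel)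
      = (\<integral>x. \<rho> x * velocity x a * velocity x b \<partial>lborel)" for a b
    using integral_moment_mult[OF _ abs_coeff_le(1) L2_field_integrable_space[OF curv_rate_L2]]
    by (simp add: velocity_def)
  have int: "integrable lborel (\<lambda>x. moment \<rho> x a * curv_rate x b)" for a b
    by (intro integrable_mult_square_integrable L2_field_space[OF momentum_L2] L2_field_space[OF curv_rate_L2])
  have "(\<integral>x. (moment \<rho> x t - moment \<rho> x t') * (curv_rate x t + curv_rate x t') \<partial>lborel)
    = (\<integral>x. moment \<rho> x t * curv_rate x t + moment \<rho> x t * curv_rate x t'
        - moment \<rho> x t' * curv_rate x t - moment \<rho> x t' * curv_rate x t' \<partial>lborel)"
    by (simp add: algebra_simps)
  also have "\<dots> = (\<integral>x. \<rho> x * velocity x t * velocity x t \<partial>lborel)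
     + (\<integral>x. \<rho> x * velocity x t * velocity x t' \<partial>lborel)
     - (\<integral>x. \<rho> x * velocity x t' * velocity x t \<partial>lborel)
     - (\<integral>x. \<rho> x * velocity x t' * velocity x t' \<partial>lborel)"
    using int by (simp add: pairing)
  also have "(\<integral>x. \<rho> x * velocity x t' * velocity x t \<partial>lborel)
      = (\<integral>x. \<rho> x * velocity x t * velocity x t' \<partial>lborel)"
    by (simp add: mult_ac)
  finally show ?thesis
    by (simp add: kinetic_def power2_eq_square mult.assoc)
qed

lemma action_increment:
  "action (\<tau> + \<delta>) - action \<tau> = (\<integral>x. primitive (\<lambda>t.
    (moment \<rho> x (t + \<delta>) - moment \<rho> x t) * (curv_rate x (t + \<delta>) + curv_rate x t)) \<tau> \<partial>lborel)"
proof -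
  have "integrable lborel (\<lambda>t. kinetic (t + \<delta>))"
    by (rule integrable_lborel_shift[OF kinetic_integrable])
  then have "action (\<tau> + \<delta>) - action \<tau> = primitive (\<lambda>t. kinetic (t + \<delta>) - kinetic t) \<tau>"
    by (simp add: action_def primitive_diff primitive_shift kinetic_integrable)
  also have "\<dots> = primitive (\<lambda>t. \<integral>x. (moment \<rho> x (t + \<delta>) - moment \<rho> x t)
      * (curv_rate x (t + \<delta>) + curv_rate x t) \<partial>lborel) \<tau>"
    by (simp add: kinetic_diff)
  also have "\<dots> = (\<integral>x. primitive (\<lambda>t.
    (moment \<rho> x (t + \<delta>) - moment \<rho> x t) * (curv_rate x (t + \<delta>) + curv_rate x t)) \<tau> \<partial>lborel)"
    by (rule integral_primitive[OF L2_field_integrable_increment_mult[OF momentum_L2 curv_rate_L2], symmetric])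
  finally show ?thesis .
qed

end

locale beam_motion = beam +
  assumes motion: "AE x in lborel. AE t in lborel. moment \<rho> x t = impulse x t"
begin

lemma action_increment_eq:
  assumes "\<tau> \<le> T" "\<tau> + \<delta> \<le> T"
  shows "action (\<tau> + \<delta>) - action \<tau> = (\<integral>x. primitive (\<lambda>t. (primitive (moment_rate x) (t + \<delta>)
    - primitive (moment_rate x) t) * (curv_rate x (t + \<delta>) + curv_rate x t)) \<tau> \<partial>lborel)"
  unfolding action_increment
proof (rule integral_cong_AE)
  show "AE x in lborel. primitive (\<lambda>t. (moment \<rho> x (t + \<delta>) - moment \<rho> x t)
          * (curv_rate x (t + \<delta>) + curv_rate x t)) \<tau>
      = primitive (\<lambda>t. (primitive (moment_rate x) (t + \<delta>) - primitive (moment_rate x) t)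
          * (curv_rate x (t + \<delta>) + curv_rate x t)) \<tau>"
    using motion
  proof eventually_elim
    case (elim x)
    have "AE t in lborel. moment \<rho> x (t + \<delta>) = impulse x (t + \<delta>)"
      using AE_borel_affine[of 1 "\<lambda>t. moment \<rho> x t = impulse x t" \<delta>] elim by (simp add: add.commute)
    with elim have "AE t in lborel. t \<le> \<tau> \<longrightarrow> moment \<rho> x (t + \<delta>) = primitive (moment_rate x) (t + \<delta>)
        \<and> moment \<rho> x t = primitive (moment_rate x) t"
      by eventually_elim (use assms in \<open>auto simp: impulse_def time_primitive_eq[OF moment_rate_L2]\<close>)
    then show ?case
      by (intro primitive_cong_AE) (auto elim!: eventually_mono)
  qed
qed measurable

lemma action_has_real_derivative:
  assumes \<tau>: "\<tau> \<le> T"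
  shows "(action has_real_derivative work \<tau>) (at \<tau> within {..T})"
  unfolding has_field_derivative_iff tendsto_at_iff_sequentially comp_def
proof (intro allI impI)
  fix Y assume Y: "\<forall>i. Y i \<in> {..T} - {\<tau>}" "Y \<longlonglongrightarrow> \<tau>"
  define X where "X n = Y n - \<tau>" for n
  have X: "X \<longlonglongrightarrow> 0" "\<And>n. X n \<noteq> 0"
    unfolding X_def using Y LIM_zero[OF Y(2)] by auto
  let ?q = "\<lambda>x \<delta>. primitive (\<lambda>t. (primitive (moment_rate x) (t + \<delta>) - primitive (moment_rate x) t)
      * (curv_rate x (t + \<delta>) + curv_rate x t)) \<tau> / \<delta>"
  note sections = L2_field_integrable_time[OF moment_rate_L2] L2_field_time[OF moment_rate_L2]
    L2_field_time[OF curv_rate_L2]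
  have "(\<lambda>n. \<integral>x. ?q x (X n) \<partial>lborel) \<longlonglongrightarrow> (\<integral>x. 2 * primitive (\<lambda>t. moment_rate x t * curv_rate x t) \<tau> \<partial>lborel)"
  proof (rule integral_dominated_convergence)
    show "integrable lborel (\<lambda>x. (\<integral>t. (moment_rate x t)\<^sup>2 \<partial>lborel) + (\<integral>t. (curv_rate x t)\<^sup>2 \<partial>lborel))"
      by (intro Bochner_Integration.integrable_add L2_field_integrable_norm_time[OF moment_rate_L2]
          L2_field_integrable_norm_time[OF curv_rate_L2])
    show "AE x in lborel. (\<lambda>n. ?q x (X n)) \<longlonglongrightarrow> 2 * primitive (\<lambda>t. moment_rate x t * curv_rate x t) \<tau>"
      by (intro AE_I2 primitive_increment_pairing_tendsto sections X)
    show "AE x in lborel. norm (?q x (X n))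
        \<le> (\<integral>t. (moment_rate x t)\<^sup>2 \<partial>lborel) + (\<integral>t. (curv_rate x t)\<^sup>2 \<partial>lborel)" for n
      unfolding real_norm_def by (intro AE_I2 abs_primitive_increment_pairing_le sections X)
  qed measurable
  moreover have "(\<integral>x. ?q x (X n) \<partial>lborel) = (action (Y n) - action \<tau>) / (Y n - \<tau>)" for n
    using action_increment_eq[OF \<tau>, of "X n"] Y(1) by (simp add: X_def)
  ultimately show "(\<lambda>n. (action (Y n) - action \<tau>) / (Y n - \<tau>)) \<longlonglongrightarrow> work \<tau>"
    by (simp add: work_def)
qed

lemma work_nonneg:
  assumes "\<tau> \<le> T"
  shows "0 \<le> work \<tau>"
proof (rule tendsto_lowerbound)
  have "(action has_real_derivative work \<tau>) (at \<tau> within {..<\<tau>})"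
    using action_has_real_derivative[OF assms] assms by (auto intro: DERIV_subset)
  then show "((\<lambda>\<sigma>. (action \<sigma> - action \<tau>) / (\<sigma> - \<tau>)) \<longlongrightarrow> work \<tau>) (at_left \<tau>)"
    by (simp add: has_field_derivative_iff)
  have "\<forall>\<^sub>F \<sigma> in at_left \<tau>. \<sigma> < \<tau>"
    by (simp add: eventually_at_filter)
  then show "\<forall>\<^sub>F \<sigma> in at_left \<tau>. 0 \<le> (action \<sigma> - action \<tau>) / (\<sigma> - \<tau>)"
    by eventually_elim (simp add: divide_nonpos_neg action_mono)
qed simp

lemma integral_kinetic_le:
  assumes work_le: "\<And>\<tau>. \<tau> \<in> {0..T} \<Longrightarrow> work \<tau> \<le> B * exp \<tau>"
  shows "(\<integral>t. kinetic t \<partial>lborel) \<le> B * (exp T - 1)"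
proof -
  have "action T - B * exp T \<le> action 0 - B * exp 0"
  proof (rule nonincreasing_if_derivative_within_nonpos[of 0 T "\<lambda>\<tau>. action \<tau> - B * exp \<tau>"
        "\<lambda>\<tau>. work \<tau> - B * exp \<tau>"])
    fix \<tau> assume \<tau>: "\<tau> \<in> {0..T}"
    then have "(action has_real_derivative work \<tau>) (at \<tau> within {0..T})"
      by (auto intro: DERIV_subset[OF action_has_real_derivative])
    then show "((\<lambda>\<tau>. action \<tau> - B * exp \<tau>) has_real_derivative work \<tau> - B * exp \<tau>) (at \<tau> within {0..T})"
      by (auto intro!: derivative_eq_intros)
    show "work \<tau> - B * exp \<tau> \<le> 0" using work_le[OF \<tau>] by simp
  qed (use T_pos in simp)
  moreover have "action 0 = (LBINT t:{0..0}. kinetic t)"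
    unfolding action_def by (rule primitive_eq_LBINT_Icc) (simp add: kinetic_eq_0)
  then have "action 0 = 0"
    by (simp add: set_integral_at_point)
  moreover have "action T = (\<integral>t. kinetic t \<partial>lborel)"
    unfolding action_def by (rule primitive_eq_integral[of T]) (simp_all add: kinetic_eq_0)
  ultimately show ?thesis by (simp add: algebra_simps)
qed

end

section \<open>The a priori estimate\<close>

lemma Young_scaled:
  fixes a b \<epsilon> :: real
  assumes "0 < \<epsilon>"
  shows "2 * a * b \<le> \<epsilon> / 2 * b\<^sup>2 + 2 / \<epsilon> * a\<^sup>2"
proof -
  have "0 \<le> (2 / \<epsilon>) * (a - \<epsilon> / 2 * b)\<^sup>2" using assms by simp
  also have "\<dots> = \<epsilon> / 2 * b\<^sup>2 + 2 / \<epsilon> * a\<^sup>2 - 2 * a * b"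
    using assms by (simp add: power2_eq_square field_simps)
  finally show ?thesis by simp
qed

text \<open>Integration by parts moves the time derivative from \<open>w\<close> onto the load; the factor
  \<open>primitive w\<close> that remains is what Gronwall's inequality controls.\<close>

lemma section_work_eq:
  assumes w: "integrable lborel w" "square_integrable lborel w" and d: "integrable lborel d"
  shows "2 * primitive (\<lambda>t. (q * primitive d t - r * primitive w t - \<kappa> * w t) * w t) \<tau>
    = 2 * (q * primitive d \<tau>) * primitive w \<tau> - 2 * q * primitive (\<lambda>t. d t * primitive w t) \<tau>
      - r * (primitive w \<tau>)\<^sup>2 - 2 * \<kappa> * primitive (\<lambda>t. (w t)\<^sup>2) \<tau>"
proof -
  note int = integrable_mult_primitive[OF w(1) d] integrable_mult_primitive[OF w(1) w(1)]
    square_integrableD[OF w(2)]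
  have "primitive (\<lambda>t. (q * primitive d t - r * primitive w t - \<kappa> * w t) * w t) \<tau>
      = primitive (\<lambda>t. q * (w t * primitive d t) - r * (w t * primitive w t) - \<kappa> * (w t)\<^sup>2) \<tau>"
    by (simp add: algebra_simps power2_eq_square)
  also have "\<dots> = q * primitive (\<lambda>t. w t * primitive d t) \<tau> - r * primitive (\<lambda>t. w t * primitive w t) \<tau>
      - \<kappa> * primitive (\<lambda>t. (w t)\<^sup>2) \<tau>"
    using int by (simp add: primitive_diff primitive_cmult)
  also have "primitive (\<lambda>t. w t * primitive d t) \<tau>
      = primitive d \<tau> * primitive w \<tau> - primitive (\<lambda>t. d t * primitive w t) \<tau>"
    using primitive_by_parts[OF d w(1), of \<tau>] by (simp add: mult.commute)
  also have "primitive (\<lambda>t. w t * primitive w t) \<tau> = (primitive w \<tau>)\<^sup>2 / 2"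
    using primitive_by_parts[OF w(1) w(1), of \<tau>] by (simp add: mult.commute power2_eq_square)
  finally show ?thesis by (simp add: algebra_simps)
qed

lemma primitive_mult_le_Young:
  assumes f: "square_integrable lborel f" and g: "square_integrable lborel g" and "0 < \<epsilon>"
  shows "2 * primitive (\<lambda>t. f t * g t) \<tau> \<le> \<epsilon> / 2 * primitive (\<lambda>t. (g t)\<^sup>2) \<tau> + 2 / \<epsilon> * (\<integral>t. (f t)\<^sup>2 \<partial>lborel)"
proof -
  note squares = square_integrableD[OF f] square_integrableD[OF g]
  have "2 * primitive (\<lambda>t. f t * g t) \<tau> \<le> primitive (\<lambda>t. \<epsilon> / 2 * (g t)\<^sup>2 + 2 / \<epsilon> * (f t)\<^sup>2) \<tau>"
    unfolding primitive_cmult[symmetric]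
  proof (rule primitive_mono)
    show "2 * (f t * g t) \<le> \<epsilon> / 2 * (g t)\<^sup>2 + 2 / \<epsilon> * (f t)\<^sup>2" for t
      using Young_scaled[OF \<open>0 < \<epsilon>\<close>, of "f t" "g t"] by (simp add: mult.assoc)
  qed (use squares integrable_mult_square_integrable[OF f g] in simp_all)
  also have "\<dots> = \<epsilon> / 2 * primitive (\<lambda>t. (g t)\<^sup>2) \<tau> + 2 / \<epsilon> * primitive (\<lambda>t. (f t)\<^sup>2) \<tau>"
    using squares by (simp only: primitive_add primitive_cmult integrable_mult_right)
  also have "\<dots> \<le> \<epsilon> / 2 * primitive (\<lambda>t. (g t)\<^sup>2) \<tau> + 2 / \<epsilon> * (\<integral>t. (f t)\<^sup>2 \<partial>lborel)"
    using abs_primitive_le[OF squares(1), of \<tau>] \<open>0 < \<epsilon>\<close> by (intro add_left_mono mult_left_mono) auto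
  finally show ?thesis .
qed

lemma section_work_le:
  assumes w: "integrable lborel w" "square_integrable lborel w"
    and d: "integrable lborel d" "square_integrable lborel d"
    and v: "square_integrable lborel v" "\<And>t. t \<le> \<tau> \<Longrightarrow> v t = primitive w t"
    and d_primitive: "(primitive d \<tau>)\<^sup>2 \<le> T * (\<integral>t. (d t)\<^sup>2 \<partial>lborel)"
    and r: "0 < r0" "r0 \<le> r" and \<kappa>: "\<kappa>0 \<le> \<kappa>"
  shows "2 * primitive (\<lambda>t. (q * primitive d t - r * primitive w t - \<kappa> * w t) * w t) \<tau>
    \<le> 2 / r0 * ((1 + T) * (\<integral>t. (d t)\<^sup>2 \<partial>lborel)) * q\<^sup>2 - r0 / 2 * (v \<tau>)\<^sup>2
      + r0 / 2 * primitive (\<lambda>t. (v t)\<^sup>2) \<tau> - 2 * \<kappa>0 * primitive (\<lambda>t. (w t)\<^sup>2) \<tau>"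
proof -
  let ?G = "\<integral>t. (d t)\<^sup>2 \<partial>lborel"
  have boundary: "2 * (q * primitive d \<tau>) * v \<tau> \<le> r0 / 2 * (v \<tau>)\<^sup>2 + 2 / r0 * q\<^sup>2 * (T * ?G)"
  proof -
    have "2 / r0 * (q * primitive d \<tau>)\<^sup>2 \<le> 2 / r0 * q\<^sup>2 * (T * ?G)"
      using mult_left_mono[OF d_primitive, of "2 / r0 * q\<^sup>2"] r(1) by (simp add: power_mult_distrib)
    with Young_scaled[OF r(1), of "q * primitive d \<tau>" "v \<tau>"] show ?thesis by linarith
  qed
  have interior: "- 2 * q * primitive (\<lambda>t. d t * primitive w t) \<tau>
      \<le> r0 / 2 * primitive (\<lambda>t. (v t)\<^sup>2) \<tau> + 2 / r0 * q\<^sup>2 * ?G"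
  proof -
    have "2 * primitive (\<lambda>t. (- q * d t) * v t) \<tau>
        \<le> r0 / 2 * primitive (\<lambda>t. (v t)\<^sup>2) \<tau> + 2 / r0 * (\<integral>t. (- q * d t)\<^sup>2 \<partial>lborel)"
      by (intro primitive_mult_le_Young square_integrable_cmult d v r)
    also have "primitive (\<lambda>t. (- q * d t) * v t) \<tau> = primitive (\<lambda>t. - q * (d t * primitive w t)) \<tau>"
      by (rule primitive_cong) (simp add: v(2))
    also have "primitive (\<lambda>t. - q * (d t * primitive w t)) \<tau> = - q * primitive (\<lambda>t. d t * primitive w t) \<tau>"
      by (rule primitive_cmult)
    finally show ?thesis by (simp add: power_mult_distrib)
  qed
  have "r0 * (v \<tau>)\<^sup>2 \<le> r * (v \<tau>)\<^sup>2"
    using r by (intro mult_right_mono) auto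
  moreover have "0 \<le> primitive (\<lambda>t. (w t)\<^sup>2) \<tau>"
    unfolding primitive_def set_lebesgue_integral_def by (intro integral_nonneg_AE) simp
  then have "\<kappa>0 * primitive (\<lambda>t. (w t)\<^sup>2) \<tau> \<le> \<kappa> * primitive (\<lambda>t. (w t)\<^sup>2) \<tau>"
    using \<kappa> by (intro mult_right_mono) auto
  moreover have "2 / r0 * ((1 + T) * ?G) * q\<^sup>2 = 2 / r0 * q\<^sup>2 * ?G + 2 / r0 * q\<^sup>2 * (T * ?G)"
    by (simp add: algebra_simps add_divide_distrib)
  ultimately show ?thesis
    using boundary interior unfolding section_work_eq[OF w d(1)] v(2)[of \<tau>, OF order.refl] by linarith
qed

lemma integral_square_affine_le:
  fixes l c :: real
  assumes l: "0 \<le> l"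
  shows "(LBINT x:{0..l}. (c + l - x)\<^sup>2) \<le> (1 + c\<^sup>2) * (l + l ^ 3 / 3)"
proof -
  have "(LBINT x:{0..l}. (c + l - x)\<^sup>2) = (\<integral>x. (c + l - x)\<^sup>2 * indicator {0..l} x \<partial>lborel)"
    by (simp add: set_lebesgue_integral_def mult.commute)
  also have "\<dots> = (- ((c + l - l) ^ 3 / 3)) - (- ((c + l - 0) ^ 3 / 3))"
    by (rule integral_FTC_Icc_real) (use l in \<open>auto intro!: derivative_eq_intros simp: power2_eq_square\<close>)
  also have "\<dots> = c\<^sup>2 * l + c * l\<^sup>2 + l ^ 3 / 3"
    by (simp add: power2_eq_square power3_eq_cube field_simps)
  also have "\<dots> \<le> (1 + c\<^sup>2) * (l + l ^ 3 / 3)"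
  proof -
    have "0 \<le> l * ((1 - c * l / 2)\<^sup>2 + (c * l)\<^sup>2 / 12)" using l by simp
    also have "\<dots> = (1 + c\<^sup>2) * (l + l ^ 3 / 3) - (c\<^sup>2 * l + c * l\<^sup>2 + l ^ 3 / 3)"
      by (simp add: power2_eq_square power3_eq_cube field_simps)
    finally show ?thesis by simp
  qed
  finally show ?thesis .
qed

context beam
begin

definition curv_norm2 :: "real \<Rightarrow> real" where
  "curv_norm2 t = (\<integral>x. (curv x t)\<^sup>2 \<partial>lborel)"

definition dissipation :: "real \<Rightarrow> real" where
  "dissipation \<tau> = (\<integral>x. primitive (\<lambda>t. (curv_rate x t)\<^sup>2) \<tau> \<partial>lborel)"

definition energy_bound :: real where
  "energy_bound = 4 / r0\<^sup>2 * ((1 + c\<^sup>2) * (l + l ^ 3 / 3)) * (1 + T) * (\<integral>t. (d t)\<^sup>2 \<partial>lborel)"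

lemma energy_bound_nonneg: "0 \<le> energy_bound"
  using l_pos T_pos by (simp add: energy_bound_def)

lemma curv_norm2_nonneg: "0 \<le> curv_norm2 t"
  by (simp add: curv_norm2_def)

lemma curv_norm2_integrable: "integrable lborel curv_norm2"
  unfolding curv_norm2_def[abs_def] by (rule L2_field_integrable_norm_space[OF curv_L2])

lemma dissipation_nonneg: "0 \<le> dissipation \<tau>"
  unfolding dissipation_def primitive_def set_lebesgue_integral_def by (intro integral_nonneg_AE AE_I2) simp

lemma curv_square_integrable: "integrable (lborel \<Otimes>\<^sub>M lborel) (\<lambda>(x, t). (curv x t)\<^sup>2)"
  and curv_rate_square_integrable: "integrable (lborel \<Otimes>\<^sub>M lborel) (\<lambda>(x, t). (curv_rate x t)\<^sup>2)"
  using L2_field_integrable_mult[OF curv_L2 curv_L2] L2_field_integrable_mult[OF curv_rate_L2 curv_rate_L2]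
  by (simp_all add: power2_eq_square)

lemma dissipation_T: "dissipation T = (\<integral>x. (\<integral>t. (curv_rate x t)\<^sup>2 \<partial>lborel) \<partial>lborel)"
  unfolding dissipation_def by (simp add: primitive_eq_integral[of T] L2_field_eq_0[OF curv_rate_L2])

lemma square_primitive_d_le: "(primitive d \<tau>)\<^sup>2 \<le> T * (\<integral>t. (d t)\<^sup>2 \<partial>lborel)"
  using square_primitive_le[OF d_L2, of 0 T \<tau>] d_support T_pos by simp

lemma work_le_undamped:
  "work \<tau> \<le> 2 * (\<integral>x. primitive (\<lambda>t. (moment_rate x t + moment \<mu> x t) * curv_rate x t) \<tau> \<partial>lborel)"
proof -
  note rate = L2_field_integrable_mult[OF moment_rate_L2 curv_rate_L2]
  note damping = L2_field_integrable_mult[OF damping_L2 curv_rate_L2]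
  have "(\<integral>x. moment \<mu> x t * curv_rate x t \<partial>lborel) = (\<integral>x. \<mu> x * (velocity x t)\<^sup>2 \<partial>lborel)" for t
    using integral_moment_mult[OF _ abs_coeff_le(2) L2_field_integrable_space[OF curv_rate_L2]]
    by (simp add: velocity_def power2_eq_square mult.assoc)
  then have "(\<integral>x. primitive (\<lambda>t. moment \<mu> x t * curv_rate x t) \<tau> \<partial>lborel)
      = primitive (\<lambda>t. \<integral>x. \<mu> x * (velocity x t)\<^sup>2 \<partial>lborel) \<tau>"
    by (simp add: integral_primitive[OF damping])
  also have "\<dots> \<ge> 0"
    unfolding primitive_def set_lebesgue_integral_def
    by (intro integral_nonneg_AE AE_I2 mult_nonneg_nonneg scaleR_nonneg_nonneg)
       (simp_all add: \<mu>_bounds integral_nonneg_AE)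
  finally have damping_nonneg: "0 \<le> (\<integral>x. primitive (\<lambda>t. moment \<mu> x t * curv_rate x t) \<tau> \<partial>lborel)" .
  have "primitive (\<lambda>t. (moment_rate x t + moment \<mu> x t) * curv_rate x t) \<tau>
      = primitive (\<lambda>t. moment_rate x t * curv_rate x t) \<tau>
        + primitive (\<lambda>t. moment \<mu> x t * curv_rate x t) \<tau>" for x
    unfolding distrib_right
    by (intro primitive_add integrable_mult_square_integrable L2_field_time[OF moment_rate_L2]
        L2_field_time[OF damping_L2] L2_field_time[OF curv_rate_L2])
  then show ?thesis
    using damping_nonneg integrable_primitive[OF rate, of \<tau>] integrable_primitive[OF damping, of \<tau>]
    by (simp add: work_def)
qed

lemma undamped_section_le:
  assumes \<tau>: "\<tau> \<in> {0..T}"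
  shows "2 * primitive (\<lambda>t. (moment_rate x t + moment \<mu> x t) * curv_rate x t) \<tau>
    \<le> 2 / r0 * ((1 + T) * (\<integral>t. (d t)\<^sup>2 \<partial>lborel)) * (indicator {0..l} x *\<^sub>R (c + l - x)\<^sup>2) - r0 / 2 * (curv x \<tau>)\<^sup>2
      + r0 / 2 * primitive (\<lambda>t. (curv x t)\<^sup>2) \<tau> - 2 * \<kappa>0 * primitive (\<lambda>t. (curv_rate x t)\<^sup>2) \<tau>"
proof (cases "x \<in> {0..l}")
  case True
  let ?w = "curv_rate x"
  have curv_eq: "curv x t = primitive ?w t" if "t \<le> \<tau>" for t
    using that \<tau> by (simp add: curv_def time_primitive_eq[OF curv_rate_L2])
  have "primitive (\<lambda>t. (moment_rate x t + moment \<mu> x t) * ?w t) \<tau>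
      = primitive (\<lambda>t. ((c + l - x) * primitive d t - r x * primitive ?w t - \<kappa> x * ?w t) * ?w t) \<tau>"
  proof (rule primitive_cong)
    show "(moment_rate x t + moment \<mu> x t) * ?w t
        = ((c + l - x) * primitive d t - r x * primitive ?w t - \<kappa> x * ?w t) * ?w t" if "t \<le> \<tau>" for t
      using True \<tau> that L2_field_eq_0[OF curv_rate_L2, of x t]
      by (cases "0 \<le> t") (simp_all add: moment_rate_def load_def curv_eq)
  qed
  then show ?thesis
    using section_work_le[OF L2_field_integrable_time[OF curv_rate_L2] L2_field_time[OF curv_rate_L2]
        d_integrable d_L2 L2_field_time[OF curv_L2] curv_eq square_primitive_d_le
        r0_pos r_bounds(1) \<kappa>_bounds(1)] True
    by simp
next
  case False
  then show ?thesis
    by (simp add: L2_field_section_eq_0[OF curv_rate_L2] L2_field_section_eq_0[OF curv_L2])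
qed

lemma energy_estimate:
  assumes \<tau>: "\<tau> \<in> {0..T}"
  shows "work \<tau> + r0 / 2 * curv_norm2 \<tau> + 2 * \<kappa>0 * dissipation \<tau>
    \<le> r0 / 2 * (energy_bound + primitive curv_norm2 \<tau>)"
proof -
  let ?G = "\<integral>t. (d t)\<^sup>2 \<partial>lborel"
  let ?R = "\<lambda>x. 2 / r0 * ((1 + T) * ?G) * (indicator {0..l} x *\<^sub>R (c + l - x)\<^sup>2) - r0 / 2 * (curv x \<tau>)\<^sup>2
      + r0 / 2 * primitive (\<lambda>t. (curv x t)\<^sup>2) \<tau> - 2 * \<kappa>0 * primitive (\<lambda>t. (curv_rate x t)\<^sup>2) \<tau>"
  have "integrable lborel (\<lambda>x. indicator {0..l} x *\<^sub>R (c + l - x)\<^sup>2)"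
    by (rule borel_integrable_compact[OF compact_Icc]) (intro continuous_intros)
  note int = this square_integrableD[OF L2_field_space[OF curv_L2], of \<tau>]
    integrable_primitive[OF curv_square_integrable, of \<tau>]
    integrable_primitive[OF curv_rate_square_integrable, of \<tau>]
  note undamped_L2 = L2_field_add[OF moment_rate_L2 damping_L2]
  have undamped: "integrable lborel (\<lambda>x. primitive (\<lambda>t. (moment_rate x t + moment \<mu> x t) * curv_rate x t) \<tau>)"
    by (rule integrable_primitive[OF L2_field_integrable_mult[OF undamped_L2 curv_rate_L2]])
  have "work \<tau> \<le> (\<integral>x. 2 * primitive (\<lambda>t. (moment_rate x t + moment \<mu> x t) * curv_rate x t) \<tau> \<partial>lborel)"
    using work_le_undamped by simp
  also have "\<dots> \<le> (\<integral>x. ?R x \<partial>lborel)"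
    by (rule integral_mono[OF _ _ undamped_section_le[OF \<tau>]]) (use undamped int in simp_all)
  also have "\<dots> = 2 / r0 * ((1 + T) * ?G) * (LBINT x:{0..l}. (c + l - x)\<^sup>2) - r0 / 2 * curv_norm2 \<tau>
      + r0 / 2 * primitive curv_norm2 \<tau> - 2 * \<kappa>0 * dissipation \<tau>"
    using int integral_primitive[OF curv_square_integrable, of \<tau>]
    by (simp add: set_lebesgue_integral_def curv_norm2_def[abs_def] dissipation_def)
  also have "2 / r0 * ((1 + T) * ?G) * (LBINT x:{0..l}. (c + l - x)\<^sup>2)
      \<le> 2 / r0 * ((1 + T) * ?G) * ((1 + c\<^sup>2) * (l + l ^ 3 / 3))"
    using integral_square_affine_le[of l c] r0_pos T_pos l_pos by (intro mult_left_mono) auto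
  also have "\<dots> = r0 / 2 * energy_bound"
    using r0_pos by (simp add: energy_bound_def power2_eq_square field_simps)
  finally show ?thesis by (simp add: algebra_simps)
qed

end

context beam_motion
begin

lemma energy_terms_le:
  assumes \<tau>: "\<tau> \<in> {0..T}"
  shows "curv_norm2 \<tau> \<le> energy_bound + primitive curv_norm2 \<tau>"
    and "work \<tau> \<le> r0 / 2 * (energy_bound + primitive curv_norm2 \<tau>)"
    and "2 * \<kappa>0 * dissipation \<tau> \<le> r0 / 2 * (energy_bound + primitive curv_norm2 \<tau>)"
proof -
  have nonneg: "0 \<le> work \<tau>" "0 \<le> r0 / 2 * curv_norm2 \<tau>" "0 \<le> 2 * \<kappa>0 * dissipation \<tau>"
    using \<tau> r0_pos \<kappa>0_pos by (simp_all add: work_nonneg curv_norm2_nonneg dissipation_nonneg)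
  note estimate = energy_estimate[OF \<tau>]
  have "r0 / 2 * curv_norm2 \<tau> \<le> r0 / 2 * (energy_bound + primitive curv_norm2 \<tau>)"
    using estimate nonneg by linarith
  then show "curv_norm2 \<tau> \<le> energy_bound + primitive curv_norm2 \<tau>"
    using r0_pos by simp
  show "work \<tau> \<le> r0 / 2 * (energy_bound + primitive curv_norm2 \<tau>)"
    using estimate nonneg by linarith
  show "2 * \<kappa>0 * dissipation \<tau> \<le> r0 / 2 * (energy_bound + primitive curv_norm2 \<tau>)"
    using estimate nonneg by linarith
qed

lemma primitive_curv_norm2_le:
  assumes "\<tau> \<in> {0..T}"
  shows "primitive curv_norm2 \<tau> \<le> energy_bound * (exp \<tau> - 1)"
proof (rule Gronwall_primitive[OF curv_norm2_integrable _ energy_terms_le(1) assms])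
  show "curv_norm2 s = 0" if "s < 0" for s
    using that by (simp add: curv_norm2_def L2_field_eq_0[OF curv_L2])
qed

lemma energy_bound_plus_primitive_le:
  "\<tau> \<in> {0..T} \<Longrightarrow> energy_bound + primitive curv_norm2 \<tau> \<le> energy_bound * exp \<tau>"
  using primitive_curv_norm2_le[of \<tau>] by (simp add: algebra_simps)

lemma curv_norm2_le:
  assumes \<tau>: "\<tau> \<in> {0..T}"
  shows "curv_norm2 \<tau> \<le> energy_bound * exp T"
proof -
  have "curv_norm2 \<tau> \<le> energy_bound * exp \<tau>"
    using energy_terms_le(1)[OF \<tau>] energy_bound_plus_primitive_le[OF \<tau>] by linarith
  also have "\<dots> \<le> energy_bound * exp T"
    using energy_bound_nonneg \<tau> by (intro mult_left_mono) auto
  finally show ?thesis .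
qed

lemma integral_curv_norm2_le: "(\<integral>t. curv_norm2 t \<partial>lborel) \<le> energy_bound * (exp T - 1)"
  using primitive_curv_norm2_le[of T] T_pos primitive_eq_integral[of T curv_norm2 T]
  by (simp add: curv_norm2_def L2_field_eq_0[OF curv_L2])

lemma integral_curv_rate_square_le:
  "2 * \<kappa>0 * (\<integral>x. (\<integral>t. (curv_rate x t)\<^sup>2 \<partial>lborel) \<partial>lborel) \<le> r0 / 2 * (energy_bound * exp T)"
proof -
  have T: "T \<in> {0..T}" using T_pos by simp
  have "r0 / 2 * (energy_bound + primitive curv_norm2 T) \<le> r0 / 2 * (energy_bound * exp T)"
    using energy_bound_plus_primitive_le[OF T] r0_pos by (intro mult_left_mono) auto
  with energy_terms_le(3)[OF T] show ?thesis
    unfolding dissipation_T by linarith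
qed

lemma integral_velocity_square_le:
  "\<rho>0 * (\<integral>t. (\<integral>x. (velocity x t)\<^sup>2 \<partial>lborel) \<partial>lborel) \<le> r0 / 2 * (energy_bound * (exp T - 1))"
proof -
  have "work \<tau> \<le> r0 / 2 * energy_bound * exp \<tau>" if \<tau>: "\<tau> \<in> {0..T}" for \<tau>
  proof -
    have "r0 / 2 * (energy_bound + primitive curv_norm2 \<tau>) \<le> r0 / 2 * (energy_bound * exp \<tau>)"
      using energy_bound_plus_primitive_le[OF \<tau>] r0_pos by (intro mult_left_mono) auto
    with energy_terms_le(2)[OF \<tau>] show ?thesis by simp
  qed
  then have kinetic_le: "(\<integral>t. kinetic t \<partial>lborel) \<le> r0 / 2 * energy_bound * (exp T - 1)"
    by (rule integral_kinetic_le)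
  have "\<rho>0 * (\<integral>x. (velocity x t)\<^sup>2 \<partial>lborel) \<le> kinetic t" for t
  proof -
    have weighted: "integrable lborel (\<lambda>x. \<rho> x * (velocity x t)\<^sup>2)"
      using integrable_mult_square_integrable[OF L2_field_space[OF coeff_velocity_L2, where t=t]
          L2_field_space[OF velocity_L2, where t=t]]
      by (simp add: power2_eq_square mult.assoc)
    have "(\<integral>x. \<rho>0 * (velocity x t)\<^sup>2 \<partial>lborel) \<le> kinetic t"
      unfolding kinetic_def
      by (rule integral_mono[OF _ weighted])
         (use square_integrableD[OF L2_field_space[OF velocity_L2]] \<rho>_bounds in \<open>auto intro: mult_right_mono\<close>)
    then show ?thesis by simp
  qed
  then have "(\<integral>t. \<rho>0 * (\<integral>x. (velocity x t)\<^sup>2 \<partial>lborel) \<partial>lborel) \<le> (\<integral>t. kinetic t \<partial>lborel)"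
    by (intro integral_mono kinetic_integrable integrable_mult_right
        L2_field_integrable_norm_space[OF velocity_L2])
  with kinetic_le show ?thesis by simp
qed

end

section \<open>Fields given up to null sets\<close>

lemma AE_lborel_pair:
  fixes R :: "'a::euclidean_space \<times> 'b::euclidean_space \<Rightarrow> bool"
  assumes "AE z in lborel. R z"
  shows "AE x in lborel. AE t in lborel. R (x, t)" and "AE t in lborel. AE x in lborel. R (x, t)"
proof -
  have pair: "AE z in lborel \<Otimes>\<^sub>M lborel. R z" using assms by (subst lborel_prod)
  show "AE x in lborel. AE t in lborel. R (x, t)" by (rule lborel_pair.AE_pair[OF pair])
  have "AE z in distr (lborel \<Otimes>\<^sub>M lborel) (lborel \<Otimes>\<^sub>M lborel) (\<lambda>(x, y). (y, x)). R z"
    using pair by (subst (asm) lborel_pair.distr_pair_swap)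
  then have "AE z in lborel \<Otimes>\<^sub>M lborel. R (case z of (x, y) \<Rightarrow> (y, x))"
    by (rule AE_distrD[rotated]) measurable
  from lborel_pair.AE_pair[OF this] show "AE t in lborel. AE x in lborel. R (x, t)" by simp
qed

lemma AE_swap_eq:
  fixes f h :: "'a::euclidean_space \<Rightarrow> 'b::euclidean_space \<Rightarrow> real"
  assumes [measurable]: "case_prod f \<in> borel_measurable (borel \<Otimes>\<^sub>M borel)"
    "case_prod h \<in> borel_measurable (borel \<Otimes>\<^sub>M borel)"
  shows "(AE x in lborel. AE t in lborel. f x t = h x t) \<longleftrightarrow> (AE t in lborel. AE x in lborel. f x t = h x t)"
  by (rule lborel_pair.AE_commute) measurable

text \<open>A weak solution is measurable on the rectangle only, which \<open>zero_ext\<close> makes global;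
  \<open>L2_version\<close> discards the sections that are not square integrable, a null set by Fubini.\<close>

definition zero_ext :: "real \<Rightarrow> real \<Rightarrow> (real \<Rightarrow> real \<Rightarrow> real) \<Rightarrow> real \<Rightarrow> real \<Rightarrow> real" where
  "zero_ext l T f x t = indicator {0..l} x * indicator {0..T} t * f x t"

definition L2_version :: "real \<Rightarrow> real \<Rightarrow> (real \<Rightarrow> real \<Rightarrow> real) \<Rightarrow> real \<Rightarrow> real \<Rightarrow> real" where
  "L2_version l T f x t =
     (if integrable lborel (\<lambda>s. (zero_ext l T f x s)\<^sup>2) \<and> integrable lborel (\<lambda>y. (zero_ext l T f y t)\<^sup>2)
      then zero_ext l T f x t else 0)"

lemma zero_ext_eq: "x \<in> {0..l} \<Longrightarrow> t \<in> {0..T} \<Longrightarrow> zero_ext l T f x t = f x t"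
  and zero_ext_eq_0: "x \<notin> {0..l} \<or> t \<notin> {0..T} \<Longrightarrow> zero_ext l T f x t = 0"
  by (auto simp: zero_ext_def)

lemma zero_ext_measurable:
  assumes "L2_on ({0..l} \<times> {0..T}) (\<lambda>(x, t). f x t)"
  shows "case_prod (zero_ext l T f) \<in> borel_measurable (borel \<Otimes>\<^sub>M borel)"
proof -
  have "indicator ({0..l} \<times> {0..T}) z *\<^sub>R (case z of (x, t) \<Rightarrow> f x t) = case_prod (zero_ext l T f) z" for z
    by (cases z) (auto simp: zero_ext_def indicator_times)
  then show ?thesis
    using assms by (simp add: L2_on_def set_borel_measurable_def borel_prod)
qed

lemma zero_ext_square_integrable:
  assumes "L2_on ({0..l} \<times> {0..T}) (\<lambda>(x, t). f x t)"
  shows "integrable (lborel \<Otimes>\<^sub>M lborel) (\<lambda>(x, t). (zero_ext l T f x t)\<^sup>2)"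
proof -
  have "indicator ({0..l} \<times> {0..T}) z *\<^sub>R (case z of (x, t) \<Rightarrow> f x t)\<^sup>2
      = (case z of (x, t) \<Rightarrow> (zero_ext l T f x t)\<^sup>2)" for z
    by (cases z) (auto simp: zero_ext_def indicator_def)
  then show ?thesis
    using assms by (simp add: L2_on_def set_integrable_def lborel_prod)
qed

lemma L2_field_L2_version:
  assumes f: "L2_on ({0..l} \<times> {0..T}) (\<lambda>(x, t). f x t)"
  shows "L2_field l T (L2_version l T f)"
proof -
  note [measurable] = zero_ext_measurable[OF f]
  have [measurable]: "case_prod (L2_version l T f) \<in> borel_measurable (borel \<Otimes>\<^sub>M borel)"
    unfolding L2_version_def[abs_def] by measurable
  have le: "\<bar>(L2_version l T f x t)\<^sup>2\<bar> \<le> (zero_ext l T f x t)\<^sup>2" for x t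
    by (simp add: L2_version_def)
  have "integrable (lborel \<Otimes>\<^sub>M lborel) (\<lambda>z. (case_prod (L2_version l T f) z)\<^sup>2)"
    by (rule integrable_if_abs_le[OF zero_ext_square_integrable[OF f]]) (use le in auto)
  moreover have "integrable lborel (\<lambda>t. (L2_version l T f x t)\<^sup>2)" for x
  proof (cases "integrable lborel (\<lambda>s. (zero_ext l T f x s)\<^sup>2)")
    case True
    show ?thesis by (rule integrable_if_abs_le[OF True _ le]) measurable
  qed (simp add: L2_version_def)
  moreover have "integrable lborel (\<lambda>x. (L2_version l T f x t)\<^sup>2)" for t
  proof (cases "integrable lborel (\<lambda>y. (zero_ext l T f y t)\<^sup>2)")
    case True
    show ?thesis by (rule integrable_if_abs_le[OF True _ le]) measurable
  qed (simp add: L2_version_def)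
  ultimately show ?thesis
    by (auto simp: L2_field_def square_integrable_def) (auto simp: L2_version_def zero_ext_eq_0)
qed

lemma AE_L2_version_eq:
  assumes f: "L2_on ({0..l} \<times> {0..T}) (\<lambda>(x, t). f x t)"
  shows "AE x in lborel. AE t in lborel. zero_ext l T f x t = L2_version l T f x t"
  using lborel_pair.AE_integrable_fst[OF zero_ext_square_integrable[OF f]]
proof eventually_elim
  case (elim x)
  from lborel_pair.AE_integrable_snd[OF zero_ext_square_integrable[OF f]] show ?case
    by eventually_elim (use elim in \<open>simp add: L2_version_def\<close>)
qed

lemma set_integral_rectangle_eq:
  assumes f: "L2_on ({0..l} \<times> {0..T}) (\<lambda>(x, t). f x t)" and F: "L2_field l T F"
    and eq: "AE x in lborel. AE t in lborel. zero_ext l T f x t = F x t"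
  shows "set_lebesgue_integral lborel ({0..l} \<times> {0..T}) (\<lambda>(x, t). (f x t)\<^sup>2)
    = (\<integral>x. (\<integral>t. (F x t)\<^sup>2 \<partial>lborel) \<partial>lborel)"
proof -
  note [measurable] = zero_ext_measurable[OF f] L2_field_measurable[OF F]
  have "indicator ({0..l} \<times> {0..T}) z *\<^sub>R (case z of (x, t) \<Rightarrow> (f x t)\<^sup>2)
      = (case z of (x, t) \<Rightarrow> (zero_ext l T f x t)\<^sup>2)" for z
    by (cases z) (auto simp: zero_ext_def indicator_def)
  then have "set_lebesgue_integral lborel ({0..l} \<times> {0..T}) (\<lambda>(x, t). (f x t)\<^sup>2)
      = (\<integral>z. (case z of (x, t) \<Rightarrow> (zero_ext l T f x t)\<^sup>2) \<partial>(lborel \<Otimes>\<^sub>M lborel))"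
    by (simp add: set_lebesgue_integral_def lborel_prod)
  also have "\<dots> = (\<integral>x. (\<integral>t. (zero_ext l T f x t)\<^sup>2 \<partial>lborel) \<partial>lborel)"
    by (rule lborel_pair.integral_fst[OF zero_ext_square_integrable[OF f], symmetric])
  also have "\<dots> = (\<integral>x. (\<integral>t. (F x t)\<^sup>2 \<partial>lborel) \<partial>lborel)"
    by (intro integral_cong_AE) (use eq in \<open>auto elim!: eventually_mono intro!: integral_cong_AE\<close>)
  finally show ?thesis .
qed

lemma L2_field_integral_swap:
  assumes F: "L2_field l T F"
  shows "(\<integral>x. (\<integral>t. (F x t)\<^sup>2 \<partial>lborel) \<partial>lborel) = (\<integral>t. (\<integral>x. (F x t)\<^sup>2 \<partial>lborel) \<partial>lborel)"
  using lborel_pair.Fubini_integral[OF L2_field_integrable_mult[OF F F]] by (simp add: power2_eq_square)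

lemma LBINT_eq_primitive_zero_ext:
  assumes "x \<in> {0..l}" "t \<in> {0..T}"
  shows "(LBINT s:{0..t}. f x s) = primitive (zero_ext l T f x) t"
proof -
  have "(LBINT s:{0..t}. f x s) = (LBINT s:{0..t}. zero_ext l T f x s)"
    by (rule set_lebesgue_integral_cong) (use assms in \<open>auto simp: zero_ext_eq\<close>)
  also have "\<dots> = primitive (zero_ext l T f x) t"
    by (rule primitive_eq_LBINT_Icc[symmetric]) (simp add: zero_ext_eq_0)
  finally show ?thesis .
qed

section \<open>Test functions\<close>

lemma deflection_eq_LBINT:
  assumes "x \<in> {0..l}"
  shows "deflection l \<phi> x = (LBINT s:{0..x}. (x - s) * \<phi> s)"
  unfolding deflection_def set_lebesgue_integral_def
  by (rule Bochner_Integration.integral_cong) (use assms in \<open>auto simp: clamped_kernel_def indicator_def\<close>)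

lemma inV_deflection:
  assumes "square_integrable lborel \<phi>"
  shows "inV l (deflection l \<phi>) \<phi>"
proof -
  have [measurable]: "\<phi> \<in> borel_measurable borel"
    using assms by (simp add: square_integrable_def)
  have "(\<lambda>x. indicator {0..l} x *\<^sub>R \<phi> x) \<in> borel_measurable lborel" by measurable
  then have "L2_on {0..l} \<phi>"
    using set_integrable_lborel[OF square_integrableD[OF assms], of "{0..l}"]
    by (simp add: L2_on_def set_borel_measurable_def)
  then show ?thesis by (simp add: inV_def deflection_eq_LBINT)
qed

lemma deflection_measurable [measurable]:
  assumes [measurable]: "\<phi> \<in> borel_measurable borel"
  shows "deflection l \<phi> \<in> borel_measurable borel"
  unfolding deflection_def[abs_def] by measurable

lemma dV_end_eq_integral:
  assumes "\<And>x. x \<notin> {0..l} \<Longrightarrow> \<phi> x = 0"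
  shows "dV_end l \<phi> = (\<integral>x. \<phi> x \<partial>lborel)"
  unfolding dV_end_def set_lebesgue_integral_def
  by (rule Bochner_Integration.integral_cong) (use assms in \<open>auto simp: indicator_def\<close>)

context beam
begin

lemma deflection_curv:
  assumes t: "t \<in> {0..T}"
  shows "deflection l (\<lambda>s. curv s t) x = primitive (velocity x) t"
proof -
  have "L2_field l T (\<lambda>s \<tau>. clamped_kernel l x s * curv_rate s \<tau>)"
    using l_pos by (intro L2_field_coeff_mult[OF curv_rate_L2 _ abs_clamped_kernel_le]) auto
  note swap = integral_primitive[OF L2_field_integrable[OF this], of t]
  have "deflection l (\<lambda>s. curv s t) x = (\<integral>s. primitive (\<lambda>\<tau>. clamped_kernel l x s * curv_rate s \<tau>) t \<partial>lborel)"
    using t by (simp add: deflection_def curv_def time_primitive_eq[OF curv_rate_L2] primitive_cmult)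
  also have "\<dots> = primitive (velocity x) t"
    unfolding swap by (simp add: velocity_def[abs_def] deflection_def)
  finally show ?thesis .
qed

lemma integral_load_mult:
  assumes \<phi>: "square_integrable lborel \<phi>" and supp: "\<And>x. x \<notin> {0..l} \<Longrightarrow> \<phi> x = 0" and t: "t \<in> {0..T}"
  shows "(\<integral>x. load x t * \<phi> x \<partial>lborel) = primitive d t * (c * dV_end l \<phi> + deflection l \<phi> l)"
proof -
  have int: "integrable lborel \<phi>"
    by (rule integrable_if_square_integrable_Icc[OF \<phi> supp])
  have defl: "clamped_kernel l l x * \<phi> x = (l - x) * \<phi> x" for x
    using supp[of x] l_pos by (auto simp: clamped_kernel_def indicator_def)
  have "square_integrable lborel (\<lambda>x. clamped_kernel l l x * \<phi> x)"
    by (rule square_integrable_bounded_mult[OF _ abs_clamped_kernel_le \<phi>]) (use l_pos in auto)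
  then have "integrable lborel (\<lambda>x. clamped_kernel l l x * \<phi> x)"
    by (rule integrable_if_square_integrable_Icc[of _ 0 l]) (use supp in auto)
  then have "(\<integral>x. c * \<phi> x + (l - x) * \<phi> x \<partial>lborel) = c * (\<integral>x. \<phi> x \<partial>lborel) + deflection l \<phi> l"
    using int by (simp add: deflection_def defl)
  moreover have "load x t * \<phi> x = primitive d t * (c * \<phi> x + (l - x) * \<phi> x)" for x
    using supp[of x] t by (cases "x \<in> {0..l}") (auto simp: load_def algebra_simps)
  ultimately show ?thesis
    using dV_end_eq_integral[OF supp] by simp
qed

lemma integral_moment_rate_mult:
  assumes \<phi>: "square_integrable lborel \<phi>" and supp: "\<And>x. x \<notin> {0..l} \<Longrightarrow> \<phi> x = 0" and t: "t \<in> {0..T}"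
  shows "(\<integral>x. moment_rate x t * \<phi> x \<partial>lborel)
    = c * primitive d t * dV_end l \<phi> + primitive d t * deflection l \<phi> l
      - (\<integral>x. moment \<mu> x t * \<phi> x \<partial>lborel) - (\<integral>x. (r x * curv x t + \<kappa> x * curv_rate x t) * \<phi> x \<partial>lborel)"
proof -
  have stress: "L2_field l T (\<lambda>x t. r x * curv x t + \<kappa> x * curv_rate x t)"
    by (intro L2_field_add L2_field_coeff_mult[of _ _ _ _ M] curv_L2 curv_rate_L2 abs_coeff_le) auto
  have int: "integrable lborel (\<lambda>x. F x t * \<phi> x)" if "L2_field l T F" for F
    by (rule integrable_mult_square_integrable[OF L2_field_space[OF that] \<phi>])
  have "(\<integral>x. moment_rate x t * \<phi> x \<partial>lborel) = (\<integral>x. load x t * \<phi> x - moment \<mu> x t * \<phi> x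
      - (r x * curv x t + \<kappa> x * curv_rate x t) * \<phi> x \<partial>lborel)"
    by (simp add: moment_rate_def algebra_simps)
  also have "\<dots> = (\<integral>x. load x t * \<phi> x \<partial>lborel) - (\<integral>x. moment \<mu> x t * \<phi> x \<partial>lborel)
      - (\<integral>x. (r x * curv x t + \<kappa> x * curv_rate x t) * \<phi> x \<partial>lborel)"
    using int[OF load_L2] int[OF damping_L2] int[OF stress]
    by (simp only: Bochner_Integration.integral_diff Bochner_Integration.integrable_diff)
  also have "(\<integral>x. load x t * \<phi> x \<partial>lborel) = primitive d t * (c * dV_end l \<phi> + deflection l \<phi> l)"
    by (rule integral_load_mult[OF assms])
  finally show ?thesis by (simp add: algebra_simps)
qed

lemma integral_impulse_mult:
  assumes \<phi>: "square_integrable lborel \<phi>" and supp: "\<And>x. x \<notin> {0..l} \<Longrightarrow> \<phi> x = 0" and t: "t \<in> {0..T}"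
  shows "(\<integral>x. impulse x t * \<phi> x \<partial>lborel) = primitive (\<lambda>s. \<integral>x. moment_rate x s * \<phi> x \<partial>lborel) t"
proof -
  have "L2_field l T (\<lambda>x t. \<phi> x * indicator {0..T} t)"
    by (intro L2_field_tensor \<phi> supp square_integrable_indicator_Icc) auto
  from L2_field_integrable_mult[OF moment_rate_L2 this]
  have "integrable (lborel \<Otimes>\<^sub>M lborel) (\<lambda>(x, s). moment_rate x s * (\<phi> x * indicator {0..T} s))" .
  moreover have "moment_rate x s * (\<phi> x * indicator {0..T} s) = \<phi> x * moment_rate x s" for x s
    by (cases "s \<in> {0..T}") (auto simp: L2_field_eq_0[OF moment_rate_L2])
  ultimately have "integrable (lborel \<Otimes>\<^sub>M lborel) (\<lambda>(x, s). \<phi> x * moment_rate x s)"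
    by simp
  from integral_primitive[OF this, of t] show ?thesis
    using t by (simp add: impulse_def time_primitive_eq[OF moment_rate_L2] primitive_cmult mult.commute)
qed

end

section \<open>Weak solutions\<close>

locale weak_beam =
  fixes l T h \<theta> \<rho>0 \<rho>1 \<mu>0 \<mu>1 r0 r1 \<kappa>0 \<kappa>1 :: real
    and \<rho>A \<mu>A rA \<kappa>A g g' :: "real \<Rightarrow> real"
    and u ut uxx uxxt :: "real \<Rightarrow> real \<Rightarrow> real"
  assumes pos: "l > 0" "T > 0"
    and coeff_set_measurable: "set_borel_measurable lborel {0..l} \<rho>A" "set_borel_measurable lborel {0..l} \<mu>A"
      "set_borel_measurable lborel {0..l} rA" "set_borel_measurable lborel {0..l} \<kappa>A"
    and lower_pos: "0 < \<rho>0" "0 \<le> \<mu>0" "0 < r0" "0 < \<kappa>0"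
    and coeff_AE: "AE x in lborel. x \<in> {0<..<l} \<longrightarrow>
           \<rho>0 \<le> \<rho>A x \<and> \<rho>A x \<le> \<rho>1 \<and> \<mu>0 \<le> \<mu>A x \<and> \<mu>A x \<le> \<mu>1 \<and>
           r0 \<le> rA x \<and> rA x \<le> r1 \<and> \<kappa>0 \<le> \<kappa>A x \<and> \<kappa>A x \<le> \<kappa>1"
    and g'_L2: "L2_on {0..T} g'"
    and g_eq: "\<forall>t\<in>{0..T}. g t = set_lebesgue_integral lborel {0..t} g'"
    and weak: "weak_solution l T h \<theta> \<rho>A \<mu>A rA \<kappa>A g u ut uxx uxxt"
begin

lemma fields_L2_on:
  "L2_on ({0..l} \<times> {0..T}) (\<lambda>(x, t). uxx x t)" "L2_on ({0..l} \<times> {0..T}) (\<lambda>(x, t). ut x t)"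
  "L2_on ({0..l} \<times> {0..T}) (\<lambda>(x, t). uxxt x t)"
  using weak by (auto simp: weak_solution_def)

lemmas zero_ext_fields_measurable [measurable] = fields_L2_on[THEN zero_ext_measurable]

lemma coeff_measurable_on [measurable]:
  "(\<lambda>x. indicator {0..l} x * \<rho>A x) \<in> borel_measurable borel"
  "(\<lambda>x. indicator {0..l} x * \<mu>A x) \<in> borel_measurable borel"
  "(\<lambda>x. indicator {0..l} x * rA x) \<in> borel_measurable borel"
  "(\<lambda>x. indicator {0..l} x * \<kappa>A x) \<in> borel_measurable borel"
  using coeff_set_measurable by (simp_all add: set_borel_measurable_def)

text \<open>Clipping makes the bounds on the coefficients hold everywhere.\<close>

definition clip :: "real \<Rightarrow> real \<Rightarrow> (real \<Rightarrow> real) \<Rightarrow> real \<Rightarrow> real" where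
  "clip a b \<beta> x = max a (min b (indicator {0..l} x * \<beta> x))"

definition coeff_bound :: real where
  "coeff_bound = \<rho>0 + \<bar>\<rho>1\<bar> + \<mu>0 + \<bar>\<mu>1\<bar> + r0 + \<bar>r1\<bar> + \<kappa>0 + \<bar>\<kappa>1\<bar>"

definition load_rate :: "real \<Rightarrow> real" where
  "load_rate t = indicator {0..T} t * g' t"

lemma clip_measurable:
  assumes [measurable]: "(\<lambda>x. indicator {0..l} x * \<beta> x) \<in> borel_measurable borel"
  shows "clip a b \<beta> \<in> borel_measurable borel"
  unfolding clip_def[abs_def] by measurable

lemma clip_AE_eq:
  "AE x in lborel. x \<in> {0..l} \<longrightarrow> clip \<rho>0 \<rho>1 \<rho>A x = \<rho>A x" "AE x in lborel. x \<in> {0..l} \<longrightarrow> clip \<mu>0 \<mu>1 \<mu>A x = \<mu>A x"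
  "AE x in lborel. x \<in> {0..l} \<longrightarrow> clip r0 r1 rA x = rA x" "AE x in lborel. x \<in> {0..l} \<longrightarrow> clip \<kappa>0 \<kappa>1 \<kappa>A x = \<kappa>A x"
  using coeff_AE AE_lborel_singleton[of 0] AE_lborel_singleton[of l]
  by (eventually_elim, auto simp: clip_def)+

lemma load_rate_L2: "square_integrable lborel load_rate"
proof -
  have "indicator {0..T} t *\<^sub>R (g' t)\<^sup>2 = (load_rate t)\<^sup>2" for t
    by (simp add: load_rate_def indicator_def)
  then show ?thesis
    using g'_L2 by (simp add: L2_on_def set_integrable_def set_borel_measurable_def square_integrable_def
        load_rate_def[abs_def])
qed

sublocale beam l T "c_theta h \<theta>" \<rho>0 r0 \<kappa>0 coeff_bound "clip \<rho>0 \<rho>1 \<rho>A" "clip \<mu>0 \<mu>1 \<mu>A" "clip r0 r1 rA"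
  "clip \<kappa>0 \<kappa>1 \<kappa>A" load_rate "L2_version l T uxxt"
proof
  show "clip \<rho>0 \<rho>1 \<rho>A \<in> borel_measurable borel" "clip \<mu>0 \<mu>1 \<mu>A \<in> borel_measurable borel"
    "clip r0 r1 rA \<in> borel_measurable borel" "clip \<kappa>0 \<kappa>1 \<kappa>A \<in> borel_measurable borel"
    by (rule clip_measurable; measurable)+
  show "L2_field l T (L2_version l T uxxt)"
    by (rule L2_field_L2_version[OF fields_L2_on(3)])
qed (use pos lower_pos load_rate_L2 in \<open>auto simp: clip_def coeff_bound_def load_rate_def\<close>)

lemma g_eq_primitive:
  assumes t: "t \<in> {0..T}"
  shows "g t = primitive load_rate t"
proof -
  have "primitive load_rate t = (LBINT s:{0..t}. load_rate s)"
    by (rule primitive_eq_LBINT_Icc) (simp add: load_rate_def)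
  also have "\<dots> = (LBINT s:{0..t}. g' s)"
    by (rule set_lebesgue_integral_cong) (use t in \<open>auto simp: load_rate_def\<close>)
  finally show ?thesis using g_eq t by simp
qed

lemma integral_load_rate_square:
  "(\<integral>t. (load_rate t)\<^sup>2 \<partial>lborel) = set_lebesgue_integral lborel {0..T} (\<lambda>t. (g' t)\<^sup>2)"
  unfolding set_lebesgue_integral_def
  by (rule Bochner_Integration.integral_cong) (auto simp: load_rate_def indicator_def)

lemma uxxt_AE_eq: "AE x in lborel. AE t in lborel. zero_ext l T uxxt x t = L2_version l T uxxt x t"
  by (rule AE_L2_version_eq[OF fields_L2_on(3)])

lemma uxx_AE_eq: "AE x in lborel. AE t in lborel. zero_ext l T uxx x t = curv x t"
proof -
  have "AE z in lborel. z \<in> {0..l} \<times> {0..T} \<longrightarrow>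
        uxx (fst z) (snd z) = set_lebesgue_integral lborel {0..snd z} (\<lambda>s. uxxt (fst z) s)"
    using weak by (simp add: weak_solution_def)
  from AE_lborel_pair(1)[OF this] uxxt_AE_eq show ?thesis
  proof eventually_elim
    case (elim x)
    have primitive_eq: "primitive (zero_ext l T uxxt x) t = primitive (L2_version l T uxxt x) t" for t
      by (rule primitive_cong_AE) (use elim(2) in \<open>auto elim!: eventually_mono\<close>)
    from elim(1) show ?case
    proof eventually_elim
      case (elim t)
      show ?case
      proof (cases "x \<in> {0..l} \<and> t \<in> {0..T}")
        case True
        then have "uxx x t = primitive (L2_version l T uxxt x) t"
          using elim LBINT_eq_primitive_zero_ext[of x l t T uxxt] by (simp add: primitive_eq)
        then show ?thesis
          using True by (simp add: zero_ext_eq curv_def time_primitive_def)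
      qed (use L2_field_eq_0[OF curv_L2, of x t] in \<open>auto simp: zero_ext_eq_0\<close>)
    qed
  qed
qed

lemma uxx_AE_eq_swap: "AE t in lborel. AE x in lborel. zero_ext l T uxx x t = curv x t"
  using uxx_AE_eq by (subst AE_swap_eq[symmetric]) simp_all

lemma deflection_uxx_AE_eq:
  "AE t in lborel. t \<in> {0..T} \<longrightarrow> (\<forall>x. deflection l (\<lambda>s. uxx s t) x = deflection l (\<lambda>s. curv s t) x)"
  using uxx_AE_eq_swap
proof eventually_elim
  case (elim t)
  show ?case
  proof (intro impI allI)
    fix x assume t: "t \<in> {0..T}"
    have "deflection l (\<lambda>s. uxx s t) x = (\<integral>s. clamped_kernel l x s * zero_ext l T uxx s t \<partial>lborel)"
      unfolding deflection_def
      by (rule Bochner_Integration.integral_cong)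
         (use t in \<open>auto simp: clamped_kernel_def zero_ext_def indicator_def\<close>)
    also have "\<dots> = deflection l (\<lambda>s. curv s t) x"
      unfolding deflection_def by (rule integral_cong_AE) (use elim in \<open>auto elim!: eventually_mono\<close>)
    finally show "deflection l (\<lambda>s. uxx s t) x = deflection l (\<lambda>s. curv s t) x" .
  qed
qed

lemma displacement_AE_eq:
  "AE x in lborel. AE t in lborel. x \<in> {0..l} \<longrightarrow> t \<in> {0..T} \<longrightarrow>
    primitive (zero_ext l T ut x) t = primitive (velocity x) t"
proof -
  let ?F = "\<lambda>v x t. indicator {0..l} x * indicator {0..T} t * primitive (v x) t"
  have "AE z in lborel. z \<in> {0..l} \<times> {0..T} \<longrightarrow>
        u (fst z) (snd z) = set_lebesgue_integral lborel {0..snd z} (\<lambda>s. ut (fst z) s)"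
    and "AE t in lborel. t \<in> {0..T} \<longrightarrow> inV l (\<lambda>x. u x t) (\<lambda>x. uxx x t)"
    using weak by (simp_all add: weak_solution_def)
  from AE_lborel_pair(2)[OF this(1)] this(2) deflection_uxx_AE_eq
  have "AE t in lborel. AE x in lborel. ?F (zero_ext l T ut) x t = ?F velocity x t"
  proof eventually_elim
    case (elim t)
    note in_V = elim(2) and deflection_eq = elim(3)
    from elim(1) show ?case
    proof eventually_elim
      case (elim x)
      show ?case
      proof (cases "x \<in> {0..l} \<and> t \<in> {0..T}")
        case True
        then have "primitive (zero_ext l T ut x) t = deflection l (\<lambda>s. uxx s t) x"
          using elim in_V LBINT_eq_primitive_zero_ext[of x l t T ut] deflection_eq_LBINT[of x l "\<lambda>s. uxx s t"]
          by (simp add: inV_def)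
        then show ?thesis
          using True deflection_eq by (simp add: deflection_curv)
      qed auto
    qed
  qed
  then have "AE x in lborel. AE t in lborel. ?F (zero_ext l T ut) x t = ?F velocity x t"
    by (subst AE_swap_eq) simp_all
  then show ?thesis
    by eventually_elim (auto elim!: eventually_mono)
qed

lemma ut_AE_eq: "AE x in lborel. AE t in lborel. zero_ext l T ut x t = velocity x t"
  using displacement_AE_eq AE_L2_version_eq[OF fields_L2_on(2)]
proof eventually_elim
  case (elim x)
  let ?v = "L2_version l T ut x"
  have version: "L2_field l T (L2_version l T ut)"
    by (rule L2_field_L2_version[OF fields_L2_on(2)])
  note [measurable] = L2_field_measurable[OF version]
  note int = L2_field_integrable_time[OF version, of x] L2_field_integrable_time[OF velocity_L2, of x]
  have primitive_eq: "primitive (zero_ext l T ut x) t = primitive ?v t" for t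
    by (rule primitive_cong_AE) (use elim(2) in \<open>auto elim!: eventually_mono\<close>)
  from elim(1) have "AE t in lborel. t \<in> {0..T} \<longrightarrow> primitive (\<lambda>t. ?v t - velocity x t) t = 0"
    by eventually_elim
       (use int L2_field_section_eq_0[OF version] L2_field_section_eq_0[OF velocity_L2] in
         \<open>cases "x \<in> {0..l}"; simp add: primitive_diff primitive_eq\<close>)
  then have "AE t in lborel. t \<in> {0..T} \<longrightarrow> ?v t - velocity x t = 0"
    by (rule AE_eq_0_if_AE_primitive_eq_0[OF Bochner_Integration.integrable_diff[OF int]])
  with elim(2) show ?case
  proof eventually_elim
    case (elim t)
    then show ?case
      using L2_field_eq_0[OF version, of x t] L2_field_eq_0[OF velocity_L2, of x t] by (cases "t \<in> {0..T}") auto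
  qed
qed

lemma ut_AE_eq_swap: "AE t in lborel. AE x in lborel. zero_ext l T ut x t = velocity x t"
  using ut_AE_eq by (subst AE_swap_eq[symmetric]) simp_all

lemma uxxt_AE_eq_swap: "AE t in lborel. AE x in lborel. zero_ext l T uxxt x t = L2_version l T uxxt x t"
  using uxxt_AE_eq by (subst AE_swap_eq[symmetric]) simp_all

lemma L2ip_ut:
  assumes "t \<in> {0..T}"
  shows "L2ip l (\<lambda>x. \<beta> x * ut x t) v = (\<integral>x. indicator {0..l} x * \<beta> x * zero_ext l T ut x t * v x \<partial>lborel)"
  unfolding L2ip_def set_lebesgue_integral_def
  by (rule Bochner_Integration.integral_cong) (use assms in \<open>auto simp: zero_ext_def indicator_def\<close>)

lemma L2ip_stress:
  assumes "t \<in> {0..T}"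
  shows "L2ip l (\<lambda>x. rA x * uxx x t + \<kappa>A x * uxxt x t) \<phi>
    = (\<integral>x. (indicator {0..l} x * rA x * zero_ext l T uxx x t
        + indicator {0..l} x * \<kappa>A x * zero_ext l T uxxt x t) * \<phi> x \<partial>lborel)"
  unfolding L2ip_def set_lebesgue_integral_def
  by (rule Bochner_Integration.integral_cong) (use assms in \<open>auto simp: zero_ext_def indicator_def\<close>)

lemma L2ip_ut_eq_moment:
  assumes [measurable]: "(\<lambda>x. indicator {0..l} x * \<beta> x) \<in> borel_measurable borel" "\<gamma> \<in> borel_measurable borel"
    and \<gamma>: "\<And>x. \<bar>\<gamma> x\<bar> \<le> C" "AE x in lborel. x \<in> {0..l} \<longrightarrow> \<gamma> x = \<beta> x"
    and \<phi>: "integrable lborel \<phi>"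
  shows "AE t in lborel. (\<integral>x. indicator {0..l} x * \<beta> x * zero_ext l T ut x t * deflection l \<phi> x \<partial>lborel)
    = (\<integral>x. moment \<gamma> x t * \<phi> x \<partial>lborel)"
  using ut_AE_eq_swap
proof eventually_elim
  case (elim t)
  have [measurable]: "\<phi> \<in> borel_measurable borel" using \<phi> by auto
  have "(\<integral>x. indicator {0..l} x * \<beta> x * zero_ext l T ut x t * deflection l \<phi> x \<partial>lborel)
      = (\<integral>x. \<gamma> x * velocity x t * deflection l \<phi> x \<partial>lborel)"
  proof (rule integral_cong_AE)
    show "AE x in lborel. indicator {0..l} x * \<beta> x * zero_ext l T ut x t * deflection l \<phi> x
        = \<gamma> x * velocity x t * deflection l \<phi> x"
      using \<gamma>(2) elim
    proof eventually_elim
      case (elim x)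
      then show ?case
        using L2_field_eq_0[OF velocity_L2, of x t] by (cases "x \<in> {0..l}") auto
    qed
  qed measurable
  then show ?case
    by (simp add: integral_moment_mult[OF assms(2) \<gamma>(1) \<phi>])
qed

lemma stress_AE_eq:
  assumes [measurable]: "\<phi> \<in> borel_measurable borel"
  shows "AE t in lborel. (\<integral>x. (indicator {0..l} x * rA x * zero_ext l T uxx x t
      + indicator {0..l} x * \<kappa>A x * zero_ext l T uxxt x t) * \<phi> x \<partial>lborel)
    = (\<integral>x. (clip r0 r1 rA x * curv x t + clip \<kappa>0 \<kappa>1 \<kappa>A x * L2_version l T uxxt x t) * \<phi> x \<partial>lborel)"
  using uxx_AE_eq_swap uxxt_AE_eq_swap
proof eventually_elim
  case (elim t)
  show ?case
  proof (rule integral_cong_AE)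
    show "AE x in lborel. (indicator {0..l} x * rA x * zero_ext l T uxx x t
        + indicator {0..l} x * \<kappa>A x * zero_ext l T uxxt x t) * \<phi> x
      = (clip r0 r1 rA x * curv x t + clip \<kappa>0 \<kappa>1 \<kappa>A x * L2_version l T uxxt x t) * \<phi> x"
      using elim clip_AE_eq(3,4)
    proof eventually_elim
      case (elim x)
      then show ?case
        using L2_field_eq_0[OF curv_L2, of x t] L2_field_eq_0[OF curv_rate_L2, of x t]
        by (cases "x \<in> {0..l}") auto
    qed
  qed measurable
qed

definition weak_rate :: "(real \<Rightarrow> real) \<Rightarrow> real \<Rightarrow> real" where
  "weak_rate \<phi> s = c_theta h \<theta> * g s * dV_end l \<phi> + g s * deflection l \<phi> l
     - L2ip l (\<lambda>x. \<mu>A x * ut x s) (deflection l \<phi>) - L2ip l (\<lambda>x. rA x * uxx x s + \<kappa>A x * uxxt x s) \<phi>"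

lemma LBINT_weak_rate:
  assumes \<phi>: "square_integrable lborel \<phi>" and supp: "\<And>x. x \<notin> {0..l} \<Longrightarrow> \<phi> x = 0" and t: "t \<in> {0..T}"
  shows "(LBINT s:{0..t}. weak_rate \<phi> s) = (\<integral>x. impulse x t * \<phi> x \<partial>lborel)"
proof -
  let ?R = "\<lambda>s. c_theta h \<theta> * primitive load_rate s * dV_end l \<phi> + primitive load_rate s * deflection l \<phi> l
      - (\<integral>x. indicator {0..l} x * \<mu>A x * zero_ext l T ut x s * deflection l \<phi> x \<partial>lborel)
      - (\<integral>x. (indicator {0..l} x * rA x * zero_ext l T uxx x s
          + indicator {0..l} x * \<kappa>A x * zero_ext l T uxxt x s) * \<phi> x \<partial>lborel)"
  have [measurable]: "\<phi> \<in> borel_measurable borel" "load_rate \<in> borel_measurable borel"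
    using \<phi> load_rate_L2 by (simp_all add: square_integrable_def)
  have int: "integrable lborel \<phi>"
    by (rule integrable_if_square_integrable_Icc[OF \<phi> supp])
  have rate_eq: "AE s in lborel. s \<in> {0..T} \<longrightarrow> ?R s = (\<integral>x. moment_rate x s * \<phi> x \<partial>lborel)"
    using L2ip_ut_eq_moment[OF coeff_measurable_on(2) coeff_measurable(2) abs_coeff_le(2) clip_AE_eq(2) int]
      stress_AE_eq[OF \<open>\<phi> \<in> borel_measurable borel\<close>]
  proof eventually_elim
    case (elim s)
    show ?case
      unfolding elim by (intro impI integral_moment_rate_mult[OF \<phi>, symmetric] supp)
  qed
  have "(LBINT s:{0..t}. weak_rate \<phi> s) = (LBINT s:{0..t}. ?R s)"
    by (rule set_lebesgue_integral_cong)
       (use t in \<open>auto simp: weak_rate_def L2ip_ut L2ip_stress g_eq_primitive\<close>)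
  also have "\<dots> = (LBINT s:{0..t}. \<integral>x. moment_rate x s * \<phi> x \<partial>lborel)"
    by (rule set_lebesgue_integral_cong_AE) (use rate_eq t in \<open>auto elim!: eventually_mono\<close>)
  also have "\<dots> = primitive (\<lambda>s. \<integral>x. moment_rate x s * \<phi> x \<partial>lborel) t"
    by (rule primitive_eq_LBINT_Icc[symmetric]) (simp add: L2_field_eq_0[OF moment_rate_L2])
  also have "\<dots> = (\<integral>x. impulse x t * \<phi> x \<partial>lborel)"
    by (rule integral_impulse_mult[OF \<phi> supp t, symmetric])
  finally show ?thesis .
qed

lemma AE_integral_moment_eq_impulse:
  assumes \<phi>: "square_integrable lborel \<phi>" and supp: "\<And>x. x \<notin> {0..l} \<Longrightarrow> \<phi> x = 0"
  shows "AE t in lborel. (\<integral>x. moment (clip \<rho>0 \<rho>1 \<rho>A) x t * \<phi> x \<partial>lborel) = (\<integral>x. impulse x t * \<phi> x \<partial>lborel)"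
proof -
  have int: "integrable lborel \<phi>"
    by (rule integrable_if_square_integrable_Icc[OF \<phi> supp])
  have weak_rate_eq: "(LBINT s:{0..t}. weak_rate \<phi> s) = (\<integral>x. impulse x t * \<phi> x \<partial>lborel)" if "t \<in> {0..T}" for t
    by (rule LBINT_weak_rate[OF \<phi> supp that])
  have "AE t in lborel. t \<in> {0..T} \<longrightarrow>
      L2ip l (\<lambda>x. \<rho>A x * ut x t) (deflection l \<phi>) = (LBINT s:{0..t}. weak_rate \<phi> s)"
    using weak inV_deflection[OF \<phi>] unfolding weak_solution_def weak_rate_def by blast
  then show ?thesis
    using L2ip_ut_eq_moment[OF coeff_measurable_on(1) coeff_measurable(1) abs_coeff_le(1) clip_AE_eq(1) int]
  proof eventually_elim
    case (elim t)
    then show ?case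
      using L2_field_eq_0[OF momentum_L2, of _ t] L2_field_eq_0[OF impulse_L2, of _ t]
      by (cases "t \<in> {0..T}") (simp_all add: weak_rate_eq L2ip_ut)
  qed
qed

lemma primitive_moment_eq_impulse:
  "AE t in lborel. primitive (\<lambda>x. moment (clip \<rho>0 \<rho>1 \<rho>A) x t - impulse x t) q = 0"
proof -
  let ?\<phi> = "\<lambda>x. indicator {0..l} x * indicator {..q} x :: real"
  have \<phi>: "square_integrable lborel ?\<phi>"
    by (rule square_integrable_if_abs_le[OF square_integrable_indicator_Icc[of 0 l]]) (auto simp: indicator_def)
  have mult: "F x t * ?\<phi> x = indicator {..q} x *\<^sub>R F x t" if "L2_field l T F" for F x t
    using L2_field_eq_0[OF that, of x t] by (auto simp: indicator_def)
  have "AE t in lborel. (\<integral>x. moment (clip \<rho>0 \<rho>1 \<rho>A) x t * ?\<phi> x \<partial>lborel) = (\<integral>x. impulse x t * ?\<phi> x \<partial>lborel)"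
    by (rule AE_integral_moment_eq_impulse[OF \<phi>]) simp
  then show ?thesis
  proof eventually_elim
    case (elim t)
    then have "primitive (\<lambda>x. moment (clip \<rho>0 \<rho>1 \<rho>A) x t) q = primitive (\<lambda>x. impulse x t) q"
      by (simp add: primitive_def set_lebesgue_integral_def mult[OF momentum_L2] mult[OF impulse_L2])
    then show ?case
      by (simp add: primitive_diff L2_field_integrable_space[OF momentum_L2]
          L2_field_integrable_space[OF impulse_L2])
  qed
qed

sublocale beam_motion l T "c_theta h \<theta>" \<rho>0 r0 \<kappa>0 coeff_bound "clip \<rho>0 \<rho>1 \<rho>A" "clip \<mu>0 \<mu>1 \<mu>A" "clip r0 r1 rA"
  "clip \<kappa>0 \<kappa>1 \<kappa>A" load_rate "L2_version l T uxxt"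
proof
  let ?D = "\<lambda>t x. moment (clip \<rho>0 \<rho>1 \<rho>A) x t - impulse x t"
  have D: "L2_field l T (\<lambda>x t. ?D t x)"
    by (rule L2_field_diff[OF momentum_L2 impulse_L2])
  have "AE q in lborel. AE t in lborel. primitive (?D t) q = 0"
    by (simp add: primitive_moment_eq_impulse)
  then have "AE t in lborel. AE q in lborel. primitive (?D t) q = 0"
    by (subst (asm) AE_swap_eq) measurable
  then have "AE t in lborel. AE x in lborel. moment (clip \<rho>0 \<rho>1 \<rho>A) x t = impulse x t"
  proof eventually_elim
    case (elim t)
    have "AE x in lborel. x \<in> {0..l} \<longrightarrow> ?D t x = 0"
      by (rule AE_eq_0_if_AE_primitive_eq_0[OF L2_field_integrable_space[OF D]]) (use elim in auto)
    then show ?case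
      by eventually_elim (use L2_field_eq_0[OF D, of _ t] in force)
  qed
  then show "AE x in lborel. AE t in lborel. moment (clip \<rho>0 \<rho>1 \<rho>A) x t = impulse x t"
    by (subst AE_swap_eq) measurable
qed

lemma uxx_section_bound:
  "AE t in lborel. t \<in> {0..T} \<longrightarrow> set_lebesgue_integral lborel {0..l} (\<lambda>x. (uxx x t)\<^sup>2) \<le> energy_bound * exp T"
  using uxx_AE_eq_swap
proof eventually_elim
  case (elim t)
  show ?case
  proof
    assume t: "t \<in> {0..T}"
    have "set_lebesgue_integral lborel {0..l} (\<lambda>x. (uxx x t)\<^sup>2) = (\<integral>x. (zero_ext l T uxx x t)\<^sup>2 \<partial>lborel)"
      unfolding set_lebesgue_integral_def
      by (rule Bochner_Integration.integral_cong) (use t in \<open>auto simp: zero_ext_def indicator_def\<close>)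
    also have "\<dots> = curv_norm2 t"
      unfolding curv_norm2_def by (rule integral_cong_AE) (use elim in \<open>auto elim!: eventually_mono\<close>)
    finally show "set_lebesgue_integral lborel {0..l} (\<lambda>x. (uxx x t)\<^sup>2) \<le> energy_bound * exp T"
      using curv_norm2_le[OF t] by simp
  qed
qed

lemma uxx_bound:
  "set_lebesgue_integral lborel ({0..l} \<times> {0..T}) (\<lambda>(x, t). (uxx x t)\<^sup>2) \<le> energy_bound * (1 + exp T)"
proof -
  have "set_lebesgue_integral lborel ({0..l} \<times> {0..T}) (\<lambda>(x, t). (uxx x t)\<^sup>2) = (\<integral>t. curv_norm2 t \<partial>lborel)"
    by (simp add: set_integral_rectangle_eq[OF fields_L2_on(1) curv_L2 uxx_AE_eq]
        L2_field_integral_swap[OF curv_L2] curv_norm2_def)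
  with integral_curv_norm2_le energy_bound_nonneg show ?thesis
    by (simp add: algebra_simps)
qed

lemma ut_bound:
  "set_lebesgue_integral lborel ({0..l} \<times> {0..T}) (\<lambda>(x, t). (ut x t)\<^sup>2)
    \<le> r0 / (2 * \<rho>0) * (energy_bound * (1 + exp T))"
proof -
  let ?I = "set_lebesgue_integral lborel ({0..l} \<times> {0..T}) (\<lambda>(x, t). (ut x t)\<^sup>2)"
  have "?I = (\<integral>t. (\<integral>x. (velocity x t)\<^sup>2 \<partial>lborel) \<partial>lborel)"
    by (simp add: set_integral_rectangle_eq[OF fields_L2_on(2) velocity_L2 ut_AE_eq]
        L2_field_integral_swap[OF velocity_L2])
  then have "\<rho>0 * ?I \<le> r0 / 2 * (energy_bound * (exp T - 1))"
    using integral_velocity_square_le by simp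
  also have "\<dots> \<le> r0 / 2 * (energy_bound * (1 + exp T))"
    using energy_bound_nonneg r0_pos by (intro mult_left_mono) auto
  finally show ?thesis
    using \<rho>0_pos by (simp add: field_simps)
qed

lemma uxxt_bound:
  "set_lebesgue_integral lborel ({0..l} \<times> {0..T}) (\<lambda>(x, t). (uxxt x t)\<^sup>2)
    \<le> r0 / (4 * \<kappa>0) * (energy_bound * (1 + exp T))"
proof -
  let ?I = "set_lebesgue_integral lborel ({0..l} \<times> {0..T}) (\<lambda>(x, t). (uxxt x t)\<^sup>2)"
  have "2 * \<kappa>0 * ?I \<le> r0 / 2 * (energy_bound * exp T)"
    using integral_curv_rate_square_le
      set_integral_rectangle_eq[OF fields_L2_on(3) curv_rate_L2 uxxt_AE_eq] by simp
  also have "\<dots> \<le> r0 / 2 * (energy_bound * (1 + exp T))"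
    using energy_bound_nonneg r0_pos by (intro mult_left_mono) auto
  finally show ?thesis
    using \<kappa>0_pos by (simp add: field_simps)
qed

lemma energy_bound_eq:
  "energy_bound = 4 * (l + l ^ 3 / 3) * (1 + T) / r0\<^sup>2 * (1 + (2 * h * cos \<theta> / pi)\<^sup>2)
    * set_lebesgue_integral lborel {0..T} (\<lambda>t. (g' t)\<^sup>2)"
  unfolding energy_bound_def integral_load_rate_square by (simp add: c_theta_def)

end

theorem theorem1:
  fixes l T h \<theta> \<rho>0 \<rho>1 \<mu>0 \<mu>1 r0 r1 \<kappa>0 \<kappa>1 :: real
    and \<rho>A \<mu> r \<kappa> g g' :: "real \<Rightarrow> real"
    and u ut uxx uxxt :: "real \<Rightarrow> real \<Rightarrow> real"
  assumes "l > 0" and "T > 0" and "h > 0"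
    and "set_borel_measurable lborel {0..l} \<rho>A" and "set_borel_measurable lborel {0..l} \<mu>"
    and "set_borel_measurable lborel {0..l} r" and "set_borel_measurable lborel {0..l} \<kappa>"
    and "0 < \<rho>0" and "0 \<le> \<mu>0" and "0 < r0" and "0 < \<kappa>0"
    and "AE x in lborel. x \<in> {0<..<l} \<longrightarrow>
           \<rho>0 \<le> \<rho>A x \<and> \<rho>A x \<le> \<rho>1 \<and> \<mu>0 \<le> \<mu> x \<and> \<mu> x \<le> \<mu>1 \<and>
           r0 \<le> r x \<and> r x \<le> r1 \<and> \<kappa>0 \<le> \<kappa> x \<and> \<kappa> x \<le> \<kappa>1"
    and "L2_on {0..T} g'"
    and "\<forall>t\<in>{0..T}. g t = set_lebesgue_integral lborel {0..t} g'"
    and "weak_solution l T h \<theta> \<rho>A \<mu> r \<kappa> g u ut uxx uxxt"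
  shows
    "let lhat = l + l^3 / 3;
         C0sq = 4 * lhat * (1 + T) / r0^2;
         C\<theta>sq = (2 * h * cos \<theta> / pi)^2;
         Cesq = exp T;
         C1sq = C0sq * (1 + C\<theta>sq) * Cesq;
         C2sq = C0sq * (1 + C\<theta>sq) * (1 + Cesq);
         G = set_lebesgue_integral lborel {0..T} (\<lambda>t. (g' t)^2)
     in (AE t in lborel. t \<in> {0..T} \<longrightarrow>
            set_lebesgue_integral lborel {0..l} (\<lambda>x. (uxx x t)^2) \<le> C1sq * G)
      \<and> set_lebesgue_integral lborel ({0..l} \<times> {0..T}) (\<lambda>(x,t). (uxx x t)^2) \<le> C2sq * G
      \<and> set_lebesgue_integral lborel ({0..l} \<times> {0..T}) (\<lambda>(x,t). (ut x t)^2)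
           \<le> r0 / (2 * \<rho>0) * C2sq * G
      \<and> set_lebesgue_integral lborel ({0..l} \<times> {0..T}) (\<lambda>(x,t). (uxxt x t)^2)
           \<le> r0 / (4 * \<kappa>0) * C2sq * G"
proof -
  interpret weak_beam l T h \<theta> \<rho>0 \<rho>1 \<mu>0 \<mu>1 r0 r1 \<kappa>0 \<kappa>1 \<rho>A \<mu> r \<kappa> g g' u ut uxx uxxt
    by standard (use assms in auto)
  define C where "C = 4 * (l + l ^ 3 / 3) * (1 + T) / r0\<^sup>2 * (1 + (2 * h * cos \<theta> / pi)\<^sup>2)"
  define G where "G = set_lebesgue_integral lborel {0..T} (\<lambda>t. (g' t)\<^sup>2)"
  have bound: "energy_bound = C * G"
    unfolding C_def G_def by (rule energy_bound_eq)
  have "C * exp T * G = energy_bound * exp T" "C * (1 + exp T) * G = energy_bound * (1 + exp T)"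
    "r0 / (2 * \<rho>0) * (C * (1 + exp T)) * G = r0 / (2 * \<rho>0) * (energy_bound * (1 + exp T))"
    "r0 / (4 * \<kappa>0) * (C * (1 + exp T)) * G = r0 / (4 * \<kappa>0) * (energy_bound * (1 + exp T))"
    by (simp_all add: bound)
  then show ?thesis
    unfolding Let_def C_def[symmetric] G_def[symmetric]
    using uxx_section_bound uxx_bound ut_bound uxxt_bound by presburger
qed

end
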